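(* Let $n\ge3$ and let $w\in W(\tilde B_{n+1})$. Then there exist unique integers $m\ge0$ and $j_s$ for $1\le s\le m$, and a unique element $x\in W(D_{n+1})$, such that $$w=\Bigl(\prod_{s=1}^m\bigl(\langle j_s,n]\,t_{n+1}\bigr)\Bigr)\,x,$$ with $-n\le j_1\le n+1$ and $-n\le j_s\le n$ for $2\le s\le m$, and, for $1\le s\le m-1$: <br>(a) $\ell(\langle j_s,n])\le\ell(\langle j_{s+1},n])$; <br>(b) if $\ell(\langle j_s,n])<n$ then $\ell(\langle j_s,n])<\ell(\langle j_{s+1},n])$; <br>(c) if $\ell(\langle j_s,n])=n$ then either $\ell(\langle j_s,n])<\ell(\langle j_{s+1},n])$ or $j_{s+1}=-j_s$. <br>Any expression $\prod_{s=1}^m(\langle j_s,n]\,t_{n+1})$ with those conditions is reduced and right lex-min, with affine length $m$.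
   Context: For $n\ge3$, $W(\tilde B_{n+1})$ is the Coxeter group with generating set $S=\{\sigma_{\bar1},\sigma_1,\dots,\sigma_n,t_{n+1}\}$ whose Coxeter graph has edges $\sigma_1-\sigma_2$, $\sigma_{\bar1}-\sigma_2$, $\sigma_i-\sigma_{i+1}$ for $2\le i\le n-1$ (all of label 3), and $\sigma_n-t_{n+1}$ of label 4. $W(D_{n+1})$ is the parabolic subgroup generated by $\sigma_{\bar1},\sigma_1,\dots,\sigma_n$. $\ell$ is the Coxeter length. Words: for $2\le i\le j$, $\langle i,j]=\sigma_i\sigma_{i+1}\cdots\sigma_j$ and $\langle -i,j]=\sigma_i\sigma_{i-1}\cdots\sigma_2\sigma_1\sigma_{\bar1}\sigma_2\cdots\sigma_{j-1}\sigma_j$; for $k\ge1$, $\langle1,k]=\sigma_1\sigma_2\cdots\sigma_k$, $\langle-1,k]=\sigma_{\bar1}\sigma_2\cdots\sigma_k$, $\langle0,k]=\sigma_1\sigma_{\bar1}\sigma_2\cdots\sigma_k$; and $\langle n+1,n]=1$. The lengths are $\ell(\langle j,n])=n-|j|+1$ if $j\ge-1$ and $\ell(\langle j,n])=n+|j|$ if $j\le-2$. The affine length of $w\in W(\tilde B_{n+1})$ is the number of occurrences of $t_{n+1}$ in a (any) reduced expression of $w$ (it does not depend on the reduced expression). Order the generators by $\sigma_{\bar1}<\sigma_1<\cdots<\sigma_n<t_{n+1}$. A reduced expression of an element is right lex-min if it is minimal, among all reduced expressions of that element, for the lexicographic order read from right to left. *)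

theory Defs
  imports "HOL-Algebra.Generated_Groups"
begin

section \<open>Coxeter groups\<close>

text \<open>
  The Coxeter group with generating set \<open>S\<close> and Coxeter matrix \<open>M\<close> is presented by the
  relations \<open>(s t)^(M s t) = 1\<close>. The relations with \<open>s = t\<close> say that generators are
  involutions, so the group is the quotient of the free monoid of words over \<open>S\<close> by the
  congruence \<open>cox_eq S M\<close>. An entry \<open>M s t = 0\<close> stands for infinity (no relation).
\<close>

inductive cox_eq :: "'a set \<Rightarrow> ('a \<Rightarrow> 'a \<Rightarrow> nat) \<Rightarrow> 'a list \<Rightarrow> 'a list \<Rightarrow> bool"
  for S M where
  relator: "u \<in> lists S \<Longrightarrow> v \<in> lists S \<Longrightarrow> s \<in> S \<Longrightarrow> t \<in> S \<Longrightarrow>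
    cox_eq S M (u @ concat (replicate (M s t) [s, t]) @ v) (u @ v)"
| refl: "u \<in> lists S \<Longrightarrow> cox_eq S M u u"
| sym: "cox_eq S M u v \<Longrightarrow> cox_eq S M v u"
| trans: "cox_eq S M u v \<Longrightarrow> cox_eq S M v w \<Longrightarrow> cox_eq S M u w"

definition cox_elt :: "'a set \<Rightarrow> ('a \<Rightarrow> 'a \<Rightarrow> nat) \<Rightarrow> 'a list \<Rightarrow> 'a list set" where
  "cox_elt S M u = {v. cox_eq S M u v}"

definition coxeter_group :: "'a set \<Rightarrow> ('a \<Rightarrow> 'a \<Rightarrow> nat) \<Rightarrow> 'a list set monoid" where
  "coxeter_group S M =
    \<lparr>carrier = cox_elt S M ` lists S,
     mult = (\<lambda>A B. \<Union>u\<in>A. \<Union>v\<in>B. cox_elt S M (u @ v)),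
     one = cox_elt S M []\<rparr>"

definition cox_length :: "'a set \<Rightarrow> ('a \<Rightarrow> 'a \<Rightarrow> nat) \<Rightarrow> 'a list set \<Rightarrow> nat" where
  "cox_length S M w = (LEAST k. \<exists>u\<in>lists S. cox_elt S M u = w \<and> length u = k)"

definition reduced_expr :: "'a set \<Rightarrow> ('a \<Rightarrow> 'a \<Rightarrow> nat) \<Rightarrow> 'a list \<Rightarrow> 'a list set \<Rightarrow> bool" where
  "reduced_expr S M u w \<longleftrightarrow>
    u \<in> lists S \<and> cox_elt S M u = w \<and> length u = cox_length S M w"

definition reduced :: "'a set \<Rightarrow> ('a \<Rightarrow> 'a \<Rightarrow> nat) \<Rightarrow> 'a list \<Rightarrow> bool" where
  "reduced S M u \<longleftrightarrow> reduced_expr S M u (cox_elt S M u)"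

definition right_lex_min :: "('a::linorder) set \<Rightarrow> ('a \<Rightarrow> 'a \<Rightarrow> nat) \<Rightarrow> 'a list \<Rightarrow> bool" where
  "right_lex_min S M u \<longleftrightarrow>
    reduced S M u \<and>
    (\<forall>v. reduced_expr S M v (cox_elt S M u) \<longrightarrow>
      v = u \<or> (rev u, rev v) \<in> lexord {(a, b). a < b})"

lemma cox_eq_lists: "cox_eq S M u v \<Longrightarrow> u \<in> lists S \<and> v \<in> lists S"
proof (induction rule: cox_eq.induct)
  case (relator u v s t)
  have "concat (replicate k [s, t]) \<in> lists S" for k
    using relator by (induction k) auto
  then show ?case using relator by auto
qed auto

lemma cox_eq_append_right:
  "cox_eq S M u v \<Longrightarrow> w \<in> lists S \<Longrightarrow> cox_eq S M (u @ w) (v @ w)"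
proof (induction rule: cox_eq.induct)
  case (relator u v s t)
  then show ?case using cox_eq.relator[of u S "v @ w" s t M] by auto
next
  case (refl u)
  then show ?case by (intro cox_eq.refl) auto
qed (auto intro: cox_eq.sym cox_eq.trans)

lemma cox_eq_append_left:
  "cox_eq S M u v \<Longrightarrow> w \<in> lists S \<Longrightarrow> cox_eq S M (w @ u) (w @ v)"
proof (induction rule: cox_eq.induct)
  case (relator u v s t)
  then show ?case using cox_eq.relator[of "w @ u" S v s t M] by auto
next
  case (refl u)
  then show ?case by (intro cox_eq.refl) auto
qed (auto intro: cox_eq.sym cox_eq.trans)

lemma cox_eq_append:
  "cox_eq S M u u' \<Longrightarrow> cox_eq S M v v' \<Longrightarrow> cox_eq S M (u @ v) (u' @ v')"
  by (meson cox_eq.trans cox_eq_append_left cox_eq_append_right cox_eq_lists)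

lemma cox_elt_eq_iff:
  assumes "u \<in> lists S"
  shows "cox_elt S M u = cox_elt S M v \<longleftrightarrow> cox_eq S M u v"
proof
  assume "cox_elt S M u = cox_elt S M v"
  then show "cox_eq S M u v"
    using cox_eq.refl[OF assms, of M] cox_eq.sym unfolding cox_elt_def by blast
next
  assume "cox_eq S M u v"
  then show "cox_elt S M u = cox_elt S M v"
    unfolding cox_elt_def using cox_eq.sym cox_eq.trans by blast
qed

lemma coxeter_group_mult:
  assumes "u \<in> lists S" and "v \<in> lists S"
  shows "cox_elt S M u \<otimes>\<^bsub>coxeter_group S M\<^esub> cox_elt S M v = cox_elt S M (u @ v)"
proof -
  have 1: "cox_elt S M (u' @ v') = cox_elt S M (u @ v)"
    if "cox_eq S M u u'" and "cox_eq S M v v'" for u' v'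
    using that assms cox_elt_eq_iff[of "u @ v" S M "u' @ v'"] cox_eq_append[OF that] by simp
  have 2: "u \<in> cox_elt S M u" "v \<in> cox_elt S M v"
    using assms by (simp_all add: cox_elt_def cox_eq.refl)
  have "(\<Union>u'\<in>cox_elt S M u. \<Union>v'\<in>cox_elt S M v. cox_elt S M (u' @ v')) = cox_elt S M (u @ v)"
  proof (intro equalityI subsetI)
    fix z assume "z \<in> (\<Union>u'\<in>cox_elt S M u. \<Union>v'\<in>cox_elt S M v. cox_elt S M (u' @ v'))"
    then obtain u' v' where "cox_eq S M u u'" "cox_eq S M v v'" "z \<in> cox_elt S M (u' @ v')"
      unfolding cox_elt_def by blast
    then show "z \<in> cox_elt S M (u @ v)" using 1 by blast
  next
    fix z assume "z \<in> cox_elt S M (u @ v)"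
    then show "z \<in> (\<Union>u'\<in>cox_elt S M u. \<Union>v'\<in>cox_elt S M v. cox_elt S M (u' @ v'))"
      using 2 by blast
  qed
  then show ?thesis by (simp add: coxeter_group_def)
qed

lemma group_coxeter_group:
  assumes diag: "\<And>s. s \<in> S \<Longrightarrow> M s s = 1"
  shows "group (coxeter_group S M)"
proof -
  let ?G = "coxeter_group S M"
  have carr: "carrier ?G = cox_elt S M ` lists S" and one: "\<one>\<^bsub>?G\<^esub> = cox_elt S M []"
    by (simp_all add: coxeter_group_def)
  have inv: "cox_eq S M (rev u @ u) []" if "u \<in> lists S" for u
    using that
  proof (induction u)
    case (Cons s u)
    then have "cox_eq S M (rev u @ concat (replicate (M s s) [s, s]) @ u) (rev u @ u)"
      by (intro cox_eq.relator) (auto simp: in_lists_conv_set)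
    then have "cox_eq S M (rev (s # u) @ s # u) (rev u @ u)"
      using Cons diag[of s] by simp
    then show ?case using Cons by (auto intro: cox_eq.trans)
  qed (auto intro: cox_eq.refl)
  show ?thesis
  proof (rule groupI)
    fix x assume "x \<in> carrier ?G"
    then obtain u where u: "u \<in> lists S" "x = cox_elt S M u" unfolding carr by blast
    then have r: "rev u \<in> lists S" by (simp add: in_lists_conv_set)
    have "cox_elt S M (rev u) \<otimes>\<^bsub>?G\<^esub> x = \<one>\<^bsub>?G\<^esub>"
      using u r coxeter_group_mult[OF r u(1), of M] inv[OF u(1)]
        cox_elt_eq_iff[of "rev u @ u" S M "[]"] one by simp
    then show "\<exists>y\<in>carrier ?G. y \<otimes>\<^bsub>?G\<^esub> x = \<one>\<^bsub>?G\<^esub>" using r carr by blast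
  next
    fix x y assume "x \<in> carrier ?G" "y \<in> carrier ?G"
    then obtain u v where "u \<in> lists S" "x = cox_elt S M u" "v \<in> lists S" "y = cox_elt S M v"
      unfolding carr by blast
    then show "x \<otimes>\<^bsub>?G\<^esub> y \<in> carrier ?G"
      unfolding carr by (simp only: coxeter_group_mult) (intro imageI, simp)
  next
    show "\<one>\<^bsub>?G\<^esub> \<in> carrier ?G"
      unfolding carr one by (intro imageI) simp
  next
    fix x y z assume "x \<in> carrier ?G" "y \<in> carrier ?G" "z \<in> carrier ?G"
    then obtain u v w where "u \<in> lists S" "x = cox_elt S M u" "v \<in> lists S" "y = cox_elt S M v"
      "w \<in> lists S" "z = cox_elt S M w"
      unfolding carr by blast
    moreover from this have "u @ v \<in> lists S" "v @ w \<in> lists S" by simp_all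
    ultimately show "x \<otimes>\<^bsub>?G\<^esub> y \<otimes>\<^bsub>?G\<^esub> z = x \<otimes>\<^bsub>?G\<^esub> (y \<otimes>\<^bsub>?G\<^esub> z)"
      by (simp only: coxeter_group_mult append_assoc)
  next
    fix x assume "x \<in> carrier ?G"
    then obtain u where "u \<in> lists S" "x = cox_elt S M u" unfolding carr by blast
    then show "\<one>\<^bsub>?G\<^esub> \<otimes>\<^bsub>?G\<^esub> x = x"
      unfolding one by (simp only: coxeter_group_mult lists.Nil append_Nil)
  qed
qed

section \<open>The affine Coxeter group of type B-tilde\<close>

text \<open>
  The generators of \<open>W_Btilde n\<close> are coded by natural numbers: \<open>0\<close> is
  \<open>\<sigma>\<close>-bar-1, \<open>i\<close> is \<open>\<sigma>\<^sub>i\<close> for \<open>1 \<le> i \<le> n\<close>, and \<open>n + 1\<close> is \<open>t\<^sub>n\<^sub>+\<^sub>1\<close>. The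
  order of the generators used for right lex-min expressions is then the usual order.
\<close>

definition Btilde_gens :: "nat \<Rightarrow> nat set" where
  "Btilde_gens n = {0..n + 1}"

definition Btilde_matrix :: "nat \<Rightarrow> nat \<Rightarrow> nat \<Rightarrow> nat" where
  "Btilde_matrix n a b =
    (if a = b then 1
     else if {a, b} = {n, n + 1} then 4
     else if {a, b} = {1, 2} \<or> {a, b} = {0, 2} \<or> (\<exists>i\<in>{2..n - 1}. {a, b} = {i, i + 1}) then 3
     else 2)"

abbreviation W_Btilde :: "nat \<Rightarrow> nat list set monoid" where
  "W_Btilde n \<equiv> coxeter_group (Btilde_gens n) (Btilde_matrix n)"

lemma group_W_Btilde: "group (W_Btilde n)"
  by (rule group_coxeter_group) (simp add: Btilde_matrix_def)

abbreviation Btilde_elt :: "nat \<Rightarrow> nat list \<Rightarrow> nat list set" where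
  "Btilde_elt n \<equiv> cox_elt (Btilde_gens n) (Btilde_matrix n)"

abbreviation Btilde_length :: "nat \<Rightarrow> nat list set \<Rightarrow> nat" where
  "Btilde_length n \<equiv> cox_length (Btilde_gens n) (Btilde_matrix n)"

definition W_D :: "nat \<Rightarrow> nat list set set" where
  "W_D n = generate (W_Btilde n) ((\<lambda>s. Btilde_elt n [s]) ` {0..n})"

text \<open>All reduced expressions of \<open>w\<close> have the same number of letters \<open>t\<^sub>n\<^sub>+\<^sub>1\<close>.\<close>

definition affine_length :: "nat \<Rightarrow> nat list set \<Rightarrow> nat" where
  "affine_length n w =
    (THE k. \<forall>u. reduced_expr (Btilde_gens n) (Btilde_matrix n) u w \<longrightarrow> count_list u (n + 1) = k)"

text \<open>
  \<open>bracket j k\<close> is the word \<open>\<langle>j, k]\<close>. For \<open>j = k + 1\<close> the first case gives the empty word.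
\<close>

definition bracket :: "int \<Rightarrow> nat \<Rightarrow> nat list" where
  "bracket j k =
    (if j \<ge> 1 then [nat j..<k + 1]
     else if j = 0 then [1, 0] @ [2..<k + 1]
     else if j = -1 then [0] @ [2..<k + 1]
     else rev [2..<nat (-j) + 1] @ [1, 0] @ [2..<k + 1])"

definition block_word :: "nat \<Rightarrow> int list \<Rightarrow> nat list" where
  "block_word n js = concat (map (\<lambda>j. bracket j n @ [n + 1]) js)"

text \<open>The sequence \<open>j\<^sub>1, \<dots>, j\<^sub>m\<close> is the list \<open>js\<close>, with \<open>j\<^sub>s = js ! (s - 1)\<close>.\<close>

definition admissible :: "nat \<Rightarrow> nat \<Rightarrow> int list \<Rightarrow> bool" where
  "admissible n m js \<longleftrightarrow>
    (let j = (\<lambda>s. js ! (s - 1));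
         L = (\<lambda>s. Btilde_length n (Btilde_elt n (bracket (j s) n)))
     in length js = m \<and>
        (m \<ge> 1 \<longrightarrow> - int n \<le> j 1 \<and> j 1 \<le> int n + 1) \<and>
        (\<forall>s\<in>{2..m}. - int n \<le> j s \<and> j s \<le> int n) \<and>
        (\<forall>s. 1 \<le> s \<and> s + 1 \<le> m \<longrightarrow>
          L s \<le> L (s + 1) \<and>
          (L s < n \<longrightarrow> L s < L (s + 1)) \<and>
          (L s = n \<longrightarrow> L s < L (s + 1) \<or> j (s + 1) = - j s)))"

end

theory Submission
  imports Defs "HOL-Combinatorics.Permutations"
begin

text \<open>
  The group acts on \<open>(n + 1)\<close>-dimensional space by affine isometries: \<open>W_D n\<close> by the signed
  permutations of type D, and the last generator by \<open>v (n + 1) \<mapsto> M - v (n + 1)\<close>.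

  Reducedness: the number of hyperplanes separating a point from the fundamental alcove changes
  by one at every generator, so a word whose path crosses a new hyperplane at each step is
  reduced. If moreover its last letter is always the least descent, it is right lex-min. For
  block words this is checked on the coordinates of the point, which stay dominant for \<open>W_D n\<close>
  after every block; conditions (a)--(c) say that the coordinate picked by a block grows.

  Uniqueness: the orbit of the origin is the integer lattice (for \<open>M = 1\<close>), \<open>W_D n\<close> fixes the
  origin, and the first block of an admissible word can be read off from the image \<open>v\<close> of the
  origin: it is the last coordinate with \<open>v k > 0\<close>, or else the first one with \<open>v k < 0\<close>. The same
  greedy rule shows that every lattice point is reached.

  Existence therefore reduces to showing that a word fixing the origin lies in \<open>W_D n\<close> as an
  element of the presented group. There the conjugates of the last generator by \<open>W_D n\<close> are
  indexed by the signed coordinates and commute unless their coordinates agree up to sign, so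
  every word is a product of elements of infinite dihedral groups, one for each coordinate, times
  an element of \<open>W_D n\<close>; the product is determined by the image of the origin.
\<close>

subsection \<open>The affine action and the length function\<close>

text \<open>All points are integral. The affine picture is dilated by \<open>M\<close>: a large odd
  \<open>M\<close> puts an integral point inside the fundamental alcove and keeps integral points
  off the short hyperplanes, while \<open>M = 1\<close> makes the orbit of the origin a lattice.
  Hence the parameter \<open>M\<close> throughout.

  Words act in two directions. \<open>fold\<close> lets the first letter act first, so prefixes of a
  word give the points of its path; it is the action of the inverse element. \<open>foldr\<close> is
  the usual left action, and over the same word each undoes the other.

  The action is only checked to respect the relations. That suffices for lower bounds on lengths and
  for the uniqueness of the blocks, since different images mean different elements. Existence needs
  the opposite: an equality in the presented group deduced from equal images of the origin.
  Faithfulness is not presupposed, so this is a computation with words. It succeeds because the maps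
  \<open>z \<mapsto> 1 - z\<close> and \<open>z \<mapsto> - 1 - z\<close> generate an infinite
  dihedral group acting simply transitively on the integers: in each coordinate the image of 0 names
  exactly one alternating product.\<close>

definition gact :: "nat \<Rightarrow> int \<Rightarrow> nat \<Rightarrow> (nat \<Rightarrow> int) \<Rightarrow> nat \<Rightarrow> int" where
  "gact n M s q =
    (if s = 0 then q(1 := - q 2, 2 := - q 1)
     else if s \<le> n then q(s := q (s + 1), s + 1 := q s)
     else q(n + 1 := M - q (n + 1)))"

lemma gact_invol: "gact n M s (gact n M s q) = q"
  by (auto simp: gact_def fun_eq_iff)

lemma fun_upd_commute4:
  assumes "a \<notin> {c, d}" "b \<notin> {c, d}"
  shows "q(a := w, b := x, c := y, d := z) = q(c := y, d := z, a := w, b := x)"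
  using assms by (auto simp: fun_eq_iff)

lemma fun_upd_commute3:
  assumes "a \<noteq> c" "b \<noteq> c"
  shows "q(a := w, b := x, c := y) = q(c := y, a := w, b := x)"
  using assms by (auto simp: fun_eq_iff)

lemma gact_comm:
  assumes "s \<le> n + 1" "t \<le> n + 1" "n \<ge> 3" "Btilde_matrix n s t = 2"
  shows "gact n M t (gact n M s q) = gact n M s (gact n M t q)"
proof -
  have *: "gact n M t (gact n M s q) = gact n M s (gact n M t q)"
    if st: "s < t" "t \<le> n + 1" "Btilde_matrix n s t = 2" for s t
  proof -
    have "s = 0 \<and> t = 1 \<or> s = 0 \<and> t \<ge> 3 \<or> s \<ge> 1 \<and> s + 2 \<le> t"
    proof (rule ccontr)
      assume "\<not> ?thesis"
      then have "s = 0 \<and> t = 2 \<or> s \<ge> 1 \<and> t = s + 1" using st(1) by linarith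
      then show False using st \<open>n \<ge> 3\<close>
        by (auto simp: Btilde_matrix_def doubleton_eq_iff split: if_splits)
    qed
    then consider "s = 0" "t = 1" | "s = 0" "t \<ge> 3" | "s \<ge> 1" "s + 2 \<le> t" by blast
    then show ?thesis
    proof cases
      case 1
      then show ?thesis using \<open>n \<ge> 3\<close>
        by (simp add: gact_def numeral_2_eq_2 fun_upd_twist)
    next
      case 2
      then show ?thesis using st \<open>n \<ge> 3\<close> fun_upd_commute3[of "Suc 0" "Suc n" 2 q]
        by (cases "t \<le> n") (simp_all add: gact_def fun_upd_commute4)
    next
      case 3
      then show ?thesis using st fun_upd_commute4[of s t "Suc t" "Suc s" q]
          fun_upd_commute3[of s "Suc n" "Suc s" q]
        by (cases "t \<le> n") (simp_all add: gact_def)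
    qed
  qed
  have "Btilde_matrix n t s = Btilde_matrix n s t"
    by (simp add: Btilde_matrix_def insert_commute eq_commute)
  then show ?thesis
    using *[of s t] *[of t s] assms by (cases s t rule: linorder_cases) simp_all
qed

lemma gact_braid:
  assumes "n \<ge> 3" "t = s + 1 \<and> 1 \<le> s \<and> t \<le> n \<or> s = 0 \<and> t = 2"
  shows "gact n M s (gact n M t (gact n M s q)) = gact n M t (gact n M s (gact n M t q))"
  using assms(2)
proof
  assume "t = s + 1 \<and> 1 \<le> s \<and> t \<le> n"
  then show ?thesis by (simp add: gact_def fun_upd_twist)
next
  assume "s = 0 \<and> t = 2"
  then show ?thesis using assms(1) by (simp add: gact_def fun_upd_twist)
qed

lemma gact_braid4:
  assumes "n \<ge> 3"
  shows "gact n M n (gact n M (n + 1) (gact n M n (gact n M (n + 1) q))) =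
    gact n M (n + 1) (gact n M n (gact n M (n + 1) (gact n M n q)))"
  using assms by (simp add: gact_def fun_upd_twist)

lemma gact_relator:
  assumes "n \<ge> 3" "s \<in> Btilde_gens n" "t \<in> Btilde_gens n"
  shows "fold (gact n M) (concat (replicate (Btilde_matrix n s t) [s, t])) q = q"
proof -
  have st: "s \<le> n + 1" "t \<le> n + 1"
    using assms by (auto simp: Btilde_gens_def)
  have adj: "(t = s + 1 \<and> 1 \<le> s \<and> t \<le> n \<or> s = 0 \<and> t = 2) \<or>
      (s = t + 1 \<and> 1 \<le> t \<and> s \<le> n \<or> t = 0 \<and> s = 2)" if "Btilde_matrix n s t = 3"
  proof -
    have "{s, t} = {1, 2} \<or> {s, t} = {0, 2} \<or> (\<exists>i\<in>{2..n - 1}. {s, t} = {i, i + 1})"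
      using that unfolding Btilde_matrix_def by (simp only: split: if_splits)
    then show ?thesis using assms(1) by (fastforce simp: doubleton_eq_iff)
  qed
  have "s = t \<or> Btilde_matrix n s t = 2 \<or> Btilde_matrix n s t = 3 \<or>
      Btilde_matrix n s t = 4 \<and> (s = n \<and> t = n + 1 \<or> s = n + 1 \<and> t = n)"
    unfolding Btilde_matrix_def doubleton_eq_iff by argo
  then consider "s = t" | "Btilde_matrix n s t = 2" | "Btilde_matrix n s t = 3"
    | "Btilde_matrix n s t = 4" "s = n \<and> t = n + 1 \<or> s = n + 1 \<and> t = n" by blast
  then show ?thesis
  proof cases
    case 1
    then show ?thesis by (simp add: Btilde_matrix_def gact_invol)
  next
    case 2
    then show ?thesis
      using gact_comm[OF st assms(1) 2] by (simp add: numeral_eq_Suc gact_invol)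
  next
    case 3
    have "gact n M s (gact n M t (gact n M s q)) = gact n M t (gact n M s (gact n M t q))" for q
      using adj[OF 3] gact_braid[OF assms(1), of t s] gact_braid[OF assms(1), of s t] by metis
    then show ?thesis using 3 by (simp add: numeral_eq_Suc gact_invol)
  next
    case 4
    have "gact n M s (gact n M t (gact n M s (gact n M t q))) =
        gact n M t (gact n M s (gact n M t (gact n M s q)))" for q
      using 4(2) gact_braid4[OF assms(1)] by metis
    then show ?thesis using 4(1) by (simp add: numeral_eq_Suc gact_invol)
  qed
qed

abbreviation eqv :: "nat \<Rightarrow> nat list \<Rightarrow> nat list \<Rightarrow> bool" where
  "eqv n \<equiv> cox_eq (Btilde_gens n) (Btilde_matrix n)"

text \<open>The action is well defined on group elements; this is the only link from the presented
  group to geometry.\<close>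

lemma fold_gact_eqv:
  assumes "eqv n u v" "n \<ge> 3"
  shows "fold (gact n M) u q = fold (gact n M) v q"
  using assms by (induction arbitrary: q rule: cox_eq.induct) (auto simp: gact_relator)

section \<open>Regular points and hyperplane counts\<close>

text \<open>Excludes the long hyperplanes only. The short ones are avoided by parity: they satisfy
  \<open>2 x = (2 k + 1) M\<close>, which has no integral solution for odd \<open>M\<close>.\<close>

definition regular :: "nat \<Rightarrow> int \<Rightarrow> (nat \<Rightarrow> int) \<Rightarrow> bool" where
  "regular n M q \<longleftrightarrow>
    (\<forall>i\<in>{1..n + 1}. \<forall>j\<in>{1..n + 1}. i \<noteq> j \<longrightarrow> \<not> M dvd q j - q i \<and> \<not> M dvd q i + q j)"

lemma regular_gact:
  assumes "regular n M q" "n \<ge> 3" "s \<le> n + 1"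
  shows "regular n M (gact n M s q)"
proof -
  define \<pi> where "\<pi> = (if s \<le> n then transpose (max s 1) (max s 1 + 1) else id)"
  let ?q = "gact n M s q"
  have \<pi>: "\<pi> i \<in> {1..n + 1}" if "i \<in> {1..n + 1}" for i
    using that assms(2) by (auto simp: \<pi>_def transpose_def)
  have inj: "\<pi> i \<noteq> \<pi> j" if "i \<noteq> j" for i j
    using that by (auto simp: \<pi>_def transpose_eq_iff)
  have q: "M dvd ?q i - q (\<pi> i) \<or> M dvd ?q i + q (\<pi> i)" for i
    using assms(2,3) by (auto simp: gact_def \<pi>_def transpose_def numeral_2_eq_2 max_def)
  have "\<not> M dvd ?q j - ?q i \<and> \<not> M dvd ?q i + ?q j"
    if ij: "i \<in> {1..n + 1}" "j \<in> {1..n + 1}" "i \<noteq> j" for i j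
  proof -
    define x y where "x = q (\<pi> i)" and "y = q (\<pi> j)"
    have nd: "\<not> M dvd y - x" "\<not> M dvd x + y"
      using assms(1) \<pi>[OF ij(1)] \<pi>[OF ij(2)] inj[OF ij(3)]
      unfolding regular_def x_def y_def by blast+
    \<comment> \<open>Modulo \<open>M\<close> each new coordinate is an old one up to sign. The
      eight identities cover the four sign choices, for the new difference and for the new sum, and
      express an old difference or sum through it.\<close>
    have eqs: "y - x = (?q j - ?q i) - (?q j - y) + (?q i - x)"
      "x + y = (?q j - ?q i) - (?q j - y) + (?q i + x)"
      "x + y = - (?q j - ?q i) + (?q j + y) - (?q i - x)"
      "y - x = - (?q j - ?q i) + (?q j + y) - (?q i + x)"
      "x + y = (?q i + ?q j) - (?q j - y) - (?q i - x)"
      "y - x = (?q i + ?q j) - (?q j - y) - (?q i + x)"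
      "y - x = - (?q i + ?q j) + (?q j + y) + (?q i - x)"
      "x + y = - (?q i + ?q j) + (?q j + y) + (?q i + x)"
      by simp_all
    show ?thesis
      using q[of i] q[of j] nd eqs unfolding x_def[symmetric] y_def[symmetric]
      by (metis dvd_add dvd_diff dvd_minus_iff)
  qed
  then show ?thesis unfolding regular_def by blast
qed

text \<open>The sums count the reflection hyperplanes \<open>x j - x i = k M\<close>, \<open>x i + x j = k M\<close>, respectively
  \<open>2 x i = (2 k + 1) M\<close>, that separate \<open>q\<close> from a point of the fundamental alcove.\<close>

definition long_inv :: "nat \<Rightarrow> int \<Rightarrow> (nat \<Rightarrow> int) \<Rightarrow> int" where
  "long_inv n M q = (\<Sum>(i, j)\<in>{(i, j). 1 \<le> i \<and> i < j \<and> j \<le> n + 1}.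
     \<bar>(q j - q i) div M\<bar> + \<bar>(q i + q j) div M\<bar>)"

definition short_inv :: "nat \<Rightarrow> int \<Rightarrow> (nat \<Rightarrow> int) \<Rightarrow> int" where
  "short_inv n M q = (\<Sum>i\<in>{1..n + 1}. \<bar>(2 * q i + M) div (2 * M)\<bar>)"

text \<open>Positive on the fundamental alcove, zero on its wall number \<open>s\<close>.\<close>

definition wall :: "nat \<Rightarrow> int \<Rightarrow> nat \<Rightarrow> (nat \<Rightarrow> int) \<Rightarrow> int" where
  "wall n M s q =
    (if s = 0 then q 1 + q 2 else if s \<le> n then q (s + 1) - q s else M - 2 * q (n + 1))"

lemma minus_div_eq:
  assumes "(M::int) > 0" "\<not> M dvd z"
  shows "(- z) div M = - (z div M) - 1"
  using assms by (simp add: zdiv_zminus1_eq_if dvd_eq_mod_eq_0)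

text \<open>\<open>\<bar>z div M\<bar>\<close> counts the multiples of \<open>M\<close> between
  \<open>z\<close> and the interval from 0 to \<open>M\<close>. Negation crosses just the multiple
  0, away from that interval exactly when \<open>z\<close> is positive.\<close>

lemma abs_minus_div:
  assumes "(M::int) > 0" "\<not> M dvd z"
  shows "\<bar>(- z) div M\<bar> = \<bar>z div M\<bar> + (if z > 0 then 1 else -1)"
proof (cases "z > 0")
  case True
  then have "z div M \<ge> 0" using assms(1) by (simp add: pos_imp_zdiv_nonneg_iff)
  then show ?thesis using minus_div_eq[OF assms] True by simp
next
  case False
  then have "z < 0" using assms(2) by (cases "z = 0") auto
  then have "z div M < 0" using assms(1) by (simp add: pos_imp_zdiv_neg_iff)
  then show ?thesis using minus_div_eq[OF assms] False by simp
qed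

lemma finite_pairs: "finite {(i::nat, j). 1 \<le> i \<and> i < j \<and> j \<le> n + 1}"
  by (rule finite_subset[of _ "{..n + 1} \<times> {..n + 1}"]) auto

text \<open>The familiar fact that a simple reflection permutes the positive roots other than its
  own: swapping two adjacent indices keeps every other pair in order.\<close>

lemma sum_pairs_transpose:
  fixes G G' :: "nat \<times> nat \<Rightarrow> int"
  assumes a: "1 \<le> a" "a \<le> n"
    and G: "\<And>i j. 1 \<le> i \<Longrightarrow> i < j \<Longrightarrow> j \<le> n + 1 \<Longrightarrow> (i, j) \<noteq> (a, a + 1) \<Longrightarrow>
      G' (i, j) = G (transpose a (a + 1) i, transpose a (a + 1) j)"
  shows "sum G' {(i, j). 1 \<le> i \<and> i < j \<and> j \<le> n + 1} - G' (a, a + 1) =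
    sum G {(i, j). 1 \<le> i \<and> i < j \<and> j \<le> n + 1} - G (a, a + 1)"
proof -
  let ?S = "{(i::nat, j). 1 \<le> i \<and> i < j \<and> j \<le> n + 1}"
  let ?t = "transpose a (a + 1)"
  let ?f = "map_prod ?t ?t"
  have inS: "(a, a + 1) \<in> ?S" using a by simp
  have sub: "?f ` (?S - {(a, a + 1)}) \<subseteq> ?S - {(a, a + 1)}"
    using a by (auto simp: transpose_def split: if_splits)
  have "bij_betw ?f (?S - {(a, a + 1)}) (?S - {(a, a + 1)})"
    by (rule bij_betw_byWitness[where f' = ?f]) (use sub in auto)
  then have "sum G (?S - {(a, a + 1)}) = (\<Sum>x\<in>?S - {(a, a + 1)}. G (?f x))"
    by (simp add: sum.reindex_bij_betw)
  also have "\<dots> = sum G' (?S - {(a, a + 1)})"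
    by (rule sum.cong[OF HOL.refl]) (use G in force)
  finally show ?thesis
    using sum.remove[OF finite_pairs inS, of G] sum.remove[OF finite_pairs inS, of G'] by simp
qed

lemma long_inv_gact:
  assumes "regular n M q" "n \<ge> 3" "s \<le> n" "M > 0"
  shows "long_inv n M (gact n M s q) = long_inv n M q + (if wall n M s q > 0 then 1 else -1)"
proof -
  define a where "a = max s 1"
  define q' where "q' = gact n M s q"
  let ?G = "\<lambda>q (i, j). \<bar>(q j - q i) div M\<bar> + \<bar>(q i + q j) div M\<bar>"
  have a: "1 \<le> a" "a \<le> n" using assms by (auto simp: a_def)
  have long: "long_inv n M r = sum (?G r) {(i, j). 1 \<le> i \<and> i < j \<and> j \<le> n + 1}" for r
    unfolding long_inv_def ..
  have "sum (?G q') {(i, j). 1 \<le> i \<and> i < j \<and> j \<le> n + 1} - ?G q' (a, a + 1) =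
    sum (?G q) {(i, j). 1 \<le> i \<and> i < j \<and> j \<le> n + 1} - ?G q (a, a + 1)"
  proof (rule sum_pairs_transpose[OF a])
    fix i j assume ij: "1 \<le> i" "i < j" "j \<le> n + 1" "(i, j) \<noteq> (a, a + 1)"
    show "?G q' (i, j) = ?G q (transpose a (a + 1) i, transpose a (a + 1) j)"
    proof (cases "s = 0")
      \<comment> \<open>Letter 0 swaps the indices 1 and 2 with a sign, which exchanges the
        difference and the sum term of a pair containing one of them.\<close>
      case True
      then have "j \<ge> 3" "a = 1" using ij by (auto simp: a_def)
      moreover have "q' = q(1 := - q 2, 2 := - q 1)" "transpose a (a + 1) = transpose 1 2"
        using True \<open>a = 1\<close> by (simp_all add: q'_def gact_def numeral_2_eq_2)
      ultimately show ?thesis using ij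
        by (cases "i = 1"; cases "i = 2") (simp_all add: add.commute)
    next
      case False
      then have "a = s" by (simp add: a_def)
      then have "q' = q(a := q (a + 1), a + 1 := q a)"
        using False assms(3) by (simp add: q'_def gact_def)
      then have "q' k = q (transpose a (a + 1) k)" for k
        by (cases "k = a"; cases "k = a + 1") simp_all
      then show ?thesis by simp
    qed
  qed
  moreover have "?G q' (a, a + 1) = ?G q (a, a + 1) + (if wall n M s q > 0 then 1 else -1)"
  proof (cases "s = 0")
    case True
    define z where "z = q 1 + q 2"
    have nd: "\<not> M dvd z" using assms(1,2) unfolding regular_def z_def by auto
    have "\<bar>(- z) div M\<bar> = \<bar>z div M\<bar> + (if z > 0 then 1 else -1)"
      by (rule abs_minus_div[OF assms(4) nd])
    moreover have "q' 1 = - q 2" "q' 2 = - q 1" "a = 1" using True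
      by (simp_all add: q'_def gact_def a_def)
    moreover have "wall n M s q = z" using True by (simp add: wall_def z_def)
    ultimately show ?thesis
      unfolding z_def by (simp add: numeral_2_eq_2[symmetric] algebra_simps)
  next
    case False
    define z where "z = q (s + 1) - q s"
    have nd: "\<not> M dvd z" using assms(1,3) False unfolding regular_def z_def by auto
    have "\<bar>(- z) div M\<bar> = \<bar>z div M\<bar> + (if z > 0 then 1 else -1)"
      by (rule abs_minus_div[OF assms(4) nd])
    moreover have "a = s" using False by (simp add: a_def)
    ultimately show ?thesis using False assms(3)
      unfolding z_def by (simp add: q'_def gact_def wall_def add.commute)
  qed
  ultimately show ?thesis unfolding long q'_def by linarith
qed

text \<open>The reflection \<open>z \<mapsto> M - z\<close> maps the interval from 0 to
  \<open>M\<close> to itself, so the number of multiples of \<open>M\<close> between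
  \<open>z\<close> and the interval is unchanged.\<close>

lemma M_minus_div_abs:
  assumes "(M::int) > 0" "\<not> M dvd z"
  shows "\<bar>(M - z) div M\<bar> = \<bar>z div M\<bar>"
proof -
  have "(M - z) div M = 1 + (- z) div M"
    using assms(1) div_add_self1[of M "- z"] by simp
  then show ?thesis using minus_div_eq[OF assms] by simp
qed

text \<open>For \<open>j = n + 1\<close> the letter turns \<open>q j - q i\<close> into
  \<open>M - (q i + q j)\<close> and \<open>q i + q j\<close> into \<open>M - (q j - q i)\<close>,
  so the two terms only trade places.\<close>

lemma long_inv_gact_last:
  assumes "regular n M q" "M > 0"
  shows "long_inv n M (gact n M (n + 1) q) = long_inv n M q"
  unfolding long_inv_def
proof (rule sum.cong[OF HOL.refl], clarify)
  fix i j :: nat assume ij: "1 \<le> i" "i < j" "j \<le> n + 1"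
  have nd: "\<not> M dvd q j - q i" "\<not> M dvd q i + q j"
    using assms(1) ij unfolding regular_def by auto
  show "\<bar>(gact n M (n + 1) q j - gact n M (n + 1) q i) div M\<bar> +
      \<bar>(gact n M (n + 1) q i + gact n M (n + 1) q j) div M\<bar> =
      \<bar>(q j - q i) div M\<bar> + \<bar>(q i + q j) div M\<bar>"
  proof (cases "j = n + 1")
    case True
    have "M - q j - q i = M - (q i + q j)" "q i + (M - q j) = M - (q j - q i)" by simp_all
    moreover have "gact n M (n + 1) q j = M - q j" "gact n M (n + 1) q i = q i"
      using True ij by (simp_all add: gact_def)
    ultimately show ?thesis
      using M_minus_div_abs[OF assms(2) nd(1)] M_minus_div_abs[OF assms(2) nd(2)]
      by (simp only: add.commute)
  next
    case False
    then show ?thesis using ij by (simp add: gact_def)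
  qed
qed

text \<open>Shared by the short hyperplane count and the taxicab norm: both sum an even function
  over coordinates that are only permuted up to sign.\<close>

lemma sum_gact:
  fixes f :: "int \<Rightarrow> int"
  assumes "\<And>x. f (- x) = f x" "n \<ge> 3" "s \<le> n"
  shows "(\<Sum>i\<in>{1..n + 1}. f (gact n M s q i)) = (\<Sum>i\<in>{1..n + 1}. f (q i))"
proof -
  define a where "a = max s 1"
  let ?t = "transpose a (a + 1)"
  have a: "1 \<le> a" "a \<le> n" using assms by (auto simp: a_def)
  have "?t permutes {1..n + 1}"
    using a by (intro permutes_swap_id) auto
  then have "(\<Sum>i\<in>{1..n + 1}. f (q i)) = (\<Sum>i\<in>{1..n + 1}. f (q (?t i)))"
    by (rule sum.permute[of _ _ "\<lambda>i. f (q i)", unfolded o_def])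
  also have "\<dots> = (\<Sum>i\<in>{1..n + 1}. f (gact n M s q i))"
  proof (rule sum.cong[OF HOL.refl])
    fix i
    show "f (q (?t i)) = f (gact n M s q i)"
    proof (cases "s = 0")
      case True
      then have "gact n M s q = q(1 := - q 2, 2 := - q 1)" "?t = transpose 1 2"
        by (simp_all add: gact_def a_def numeral_2_eq_2)
      then show ?thesis using assms(1)[of "q 1"] assms(1)[of "q 2"]
        by (cases "i = 1"; cases "i = 2") simp_all
    next
      case False
      then have "a = s" by (simp add: a_def)
      then have "gact n M s q = q(a := q (a + 1), a + 1 := q a)"
        using False assms(3) by (simp add: gact_def)
      then show ?thesis
        by (cases "i = a"; cases "i = a + 1") simp_all
    qed
  qed
  finally show ?thesis by simp
qed

lemma short_inv_gact:
  assumes "odd M" "M > 0" "n \<ge> 3" "s \<le> n"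
  shows "short_inv n M (gact n M s q) = short_inv n M q"
proof -
  have "\<bar>(2 * (- x) + M) div (2 * M)\<bar> = \<bar>(2 * x + M) div (2 * M)\<bar>" for x
  proof -
    have nd: "\<not> 2 * M dvd 2 * x + M"
      using assms(1) by (meson dvd_mult_left even_add dvd_triv_left)
    have "(2 * (- x) + M) div (2 * M) = (2 * M - (2 * x + M)) div (2 * M)" by simp
    then show ?thesis using M_minus_div_abs[OF _ nd] assms(2) by simp
  qed
  then show ?thesis unfolding short_inv_def by (intro sum_gact assms(3,4))
qed

text \<open>If \<open>d\<close> is the signed number of short hyperplanes passed by the last
  coordinate, the reflection in \<open>2 x = M\<close> turns \<open>d\<close> into
  \<open>1 - d\<close>. The absolute value grows exactly for \<open>d \<le> 0\<close>, that is, on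
  the inner side of the wall.\<close>

lemma short_inv_gact_last:
  assumes "odd M" "M > 0"
  shows "short_inv n M (gact n M (n + 1) q) =
    short_inv n M q + (if wall n M (n + 1) q > 0 then 1 else -1)"
proof -
  define d where "d = (2 * q (n + 1) + M) div (2 * M)"
  let ?z = "2 * q (n + 1) + M"
  have nd: "\<not> 2 * M dvd ?z"
    using assms(1) by (meson dvd_mult_left even_add dvd_triv_left)
  have "(2 * (M - q (n + 1)) + M) div (2 * M) = (2 * (2 * M) + (- ?z)) div (2 * M)"
    by simp
  also have "\<dots> = 2 + (- ?z) div (2 * M)"
    using assms(2) by (subst div_mult_self3) auto
  also have "\<dots> = 1 - d"
    using minus_div_eq[of "2 * M" ?z] nd assms(2) by (simp add: d_def)
  finally have e: "(2 * (M - q (n + 1)) + M) div (2 * M) = 1 - d" .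
  have d: "d \<le> 0 \<longleftrightarrow> wall n M (n + 1) q > 0"
  proof -
    have "d \<le> 0 \<longleftrightarrow> ?z < 2 * M"
      unfolding d_def using assms(2) by (metis add.commute add_0 div_pos_pos_trivial
        linorder_not_le pos_imp_zdiv_pos_iff zero_less_mult_iff zero_less_numeral)
    then show ?thesis by (auto simp: wall_def)
  qed
  have "(\<Sum>i\<in>{1..n}. \<bar>(2 * gact n M (n + 1) q i + M) div (2 * M)\<bar>) =
    (\<Sum>i\<in>{1..n}. \<bar>(2 * q i + M) div (2 * M)\<bar>)"
    by (rule sum.cong) (auto simp: gact_def)
  moreover have "{1..n + 1} = insert (n + 1) {1..n}" by auto
  moreover have "gact n M (n + 1) q (n + 1) = M - q (n + 1)" by (simp add: gact_def)
  ultimately show ?thesis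
    unfolding short_inv_def using e d d_def by auto
qed

section \<open>An integral base point and bounds on the length\<close>

text \<open>The point \<open>(0, 1, ..., n)\<close> is interior to the fundamental alcove exactly
  when \<open>M > 2 n\<close>. The least such integer is \<open>2 n + 1\<close>, and it is odd as
  the short hyperplanes require.\<close>

definition base_point :: "nat \<Rightarrow> int" where
  "base_point i = int i - 1"

abbreviation period :: "nat \<Rightarrow> int" where
  "period n \<equiv> 2 * int n + 1"

abbreviation path :: "nat \<Rightarrow> nat list \<Rightarrow> nat \<Rightarrow> int" where
  "path n u \<equiv> fold (gact n (period n)) u base_point"

abbreviation inversions :: "nat \<Rightarrow> (nat \<Rightarrow> int) \<Rightarrow> int" where
  "inversions n q \<equiv> long_inv n (period n) q + short_inv n (period n) q"

lemma not_dvd_small: "(0::int) < z \<Longrightarrow> z < M \<Longrightarrow> \<not> M dvd z"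
  using zdvd_not_zless by blast

lemma regular_base_point: "regular n (period n) base_point"
  unfolding regular_def
proof (intro ballI impI conjI)
  fix i j assume ij: "i \<in> {1..n + 1}" "j \<in> {1..n + 1}" "i \<noteq> j"
  show "\<not> period n dvd base_point i + base_point j"
    by (rule not_dvd_small) (use ij in \<open>auto simp: base_point_def\<close>)
  show "\<not> period n dvd base_point j - base_point i"
  proof (cases "i < j")
    case True
    then show ?thesis
      by (intro not_dvd_small) (use ij in \<open>auto simp: base_point_def\<close>)
  next
    case False
    then have "\<not> period n dvd base_point i - base_point j"
      by (intro not_dvd_small) (use ij in \<open>auto simp: base_point_def\<close>)
    then show ?thesis by (metis dvd_minus_iff minus_diff_eq)
  qed
qed

lemma inversions_base_point: "long_inv n (period n) base_point = 0" "short_inv n (period n) base_point = 0"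
  unfolding long_inv_def short_inv_def
  by (rule sum.neutral; auto simp: base_point_def div_pos_pos_trivial)+

lemma Btilde_gens_iff: "s \<in> Btilde_gens n \<longleftrightarrow> s \<le> n + 1"
  by (simp add: Btilde_gens_def)

lemma regular_path:
  assumes "u \<in> lists (Btilde_gens n)" "n \<ge> 3"
  shows "regular n (period n) (path n u)"
  using assms by (induction u rule: rev_induct)
    (auto simp: regular_base_point regular_gact Btilde_gens_iff)

text \<open>Each letter changes exactly one of the two counts. Keeping them apart is what makes the
  number of letters \<open>n + 1\<close> accessible.\<close>

lemma inversions_step:
  assumes "regular n (period n) q" "n \<ge> 3" "s \<le> n + 1"
  shows "long_inv n (period n) (gact n (period n) s q) = long_inv n (period n) q +
      (if s \<le> n then if wall n (period n) s q > 0 then 1 else -1 else 0)"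
    and "short_inv n (period n) (gact n (period n) s q) = short_inv n (period n) q +
      (if s \<le> n then 0 else if wall n (period n) s q > 0 then 1 else -1)"
proof -
  have M: "odd (period n)" "period n > 0" by simp_all
  consider "s \<le> n" | "s = n + 1" using assms(3) by linarith
  then show "long_inv n (period n) (gact n (period n) s q) = long_inv n (period n) q +
      (if s \<le> n then if wall n (period n) s q > 0 then 1 else -1 else 0)"
    using long_inv_gact[OF assms(1,2) _ M(2)] long_inv_gact_last[OF assms(1) M(2)]
    by cases auto
  consider "s \<le> n" | "s = n + 1" using assms(3) by linarith
  then show "short_inv n (period n) (gact n (period n) s q) = short_inv n (period n) q +
      (if s \<le> n then 0 else if wall n (period n) s q > 0 then 1 else -1)"
    using short_inv_gact[OF M assms(2)] short_inv_gact_last[OF M]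
    by cases auto
qed

lemma inversions_step_pos:
  assumes "regular n (period n) q" "n \<ge> 3" "s \<le> n + 1" "wall n (period n) s q > 0"
  shows "inversions n (gact n (period n) s q) = inversions n q + 1"
  using inversions_step[OF assms(1-3)] assms(4) by simp

text \<open>The two bounds add up to the length. A word whose length equals the total count
  therefore attains both, so its number of letters \<open>n + 1\<close> is the short count of its
  endpoint; this yields the affine length.\<close>

lemma inversions_le:
  assumes "u \<in> lists (Btilde_gens n)" "n \<ge> 3"
  shows "long_inv n (period n) (path n u) \<le> int (length u) - int (count_list u (n + 1)) \<and>
    short_inv n (period n) (path n u) \<le> int (count_list u (n + 1))"
  using assms(1)
proof (induction u rule: rev_induct)
  case Nil
  then show ?case by (simp add: inversions_base_point)
next
  case (snoc s u)
  then have "s \<le> n + 1" "u \<in> lists (Btilde_gens n)" by (auto simp: Btilde_gens_iff)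
  then show ?case
    using inversions_step[OF regular_path assms(2), of u s] snoc.IH assms(2) by auto
qed

text \<open>Each step crosses a wall away from the base point, and its letter is the least among the
  walls that could be crossed back.\<close>

fun lexmin_path :: "nat \<Rightarrow> int \<Rightarrow> (nat \<Rightarrow> int) \<Rightarrow> nat list \<Rightarrow> bool" where
  "lexmin_path n M q [] \<longleftrightarrow> True"
| "lexmin_path n M q (s # u) \<longleftrightarrow> wall n M s q > 0 \<and>
    (\<forall>r<s. wall n M r (gact n M s q) > 0) \<and> lexmin_path n M (gact n M s q) u"

lemma lexmin_path_append:
  "lexmin_path n M q (u @ v) \<longleftrightarrow> lexmin_path n M q u \<and> lexmin_path n M (fold (gact n M) u q) v"
  by (induction u arbitrary: q) auto

lemma lexmin_path_inversions:
  assumes "u \<in> lists (Btilde_gens n)" "n \<ge> 3" "lexmin_path n (period n) base_point u"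
  shows "inversions n (path n u) = int (length u)"
  using assms(1,3)
proof (induction u rule: rev_induct)
  case Nil
  then show ?case by (simp add: inversions_base_point)
next
  case (snoc s u)
  then have "s \<le> n + 1" "u \<in> lists (Btilde_gens n)" "wall n (period n) s (path n u) > 0"
    by (auto simp: Btilde_gens_iff lexmin_path_append)
  then show ?case
    using inversions_step_pos[OF regular_path assms(2), of u s] snoc assms(2)
    by (auto simp: lexmin_path_append)
qed

text \<open>Last letters are compared first. If \<open>v\<close> ended in a letter
  \<open>r < s\<close>, undoing \<open>r\<close> at the common endpoint would add a hyperplane,
  leaving a point with more hyperplanes than the rest of \<open>v\<close> has letters.\<close>

lemma lexmin_path_lex:
  assumes "n \<ge> 3" "u \<in> lists (Btilde_gens n)" "lexmin_path n (period n) base_point u"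
    and "v \<in> lists (Btilde_gens n)" "length v = length u" "path n v = path n u"
  shows "v = u \<or> (rev u, rev v) \<in> lexord {(a, b). a < b}"
  using assms(2-)
proof (induction u arbitrary: v rule: rev_induct)
  case (snoc s u)
  have "v \<noteq> []" using snoc.prems(4) by auto
  then obtain v' r where v: "v = v' @ [r]" by (metis rev_exhaust)
  have u: "u \<in> lists (Btilde_gens n)" "s \<le> n + 1" and v': "v' \<in> lists (Btilde_gens n)" "r \<le> n + 1"
    using snoc.prems(1,3) v by (auto simp: Btilde_gens_iff)
  have lex: "lexmin_path n (period n) base_point u"
    "\<And>r. r < s \<Longrightarrow> wall n (period n) r (path n (u @ [s])) > 0"
    using snoc.prems(2) by (auto simp: lexmin_path_append)
  have v'_path: "path n v' = gact n (period n) r (path n (u @ [s]))"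
    unfolding snoc.prems(5)[symmetric] by (simp add: v gact_invol)
  have "\<not> r < s"
  proof
    assume "r < s"
    then have "inversions n (path n v') = inversions n (path n (u @ [s])) + 1"
      unfolding v'_path using lex(2) u v'(2) assms(1) snoc.prems(1)
      by (intro inversions_step_pos regular_path) auto
    moreover have "inversions n (path n (u @ [s])) = int (length (u @ [s]))"
      by (rule lexmin_path_inversions[OF snoc.prems(1) assms(1) snoc.prems(2)])
    moreover have "inversions n (path n v') \<le> int (length v')"
      using inversions_le[OF v'(1) assms(1)] by linarith
    ultimately show False using snoc.prems(4) v by simp
  qed
  then consider "s < r" | "r = s" by linarith
  then show ?case
  proof cases
    case 1
    then show ?thesis by (simp add: v)
  next
    case 2
    then have "path n v' = path n u" using v'_path by (simp add: gact_invol)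
    then show ?thesis
      using snoc.IH[OF u(1) lex(1) v'(1)] snoc.prems(4) by (simp add: v 2)
  qed
qed auto

lemma lexmin_path_length:
  assumes "n \<ge> 3" "u \<in> lists (Btilde_gens n)" "lexmin_path n (period n) base_point u"
  shows "Btilde_length n (Btilde_elt n u) = length u"
  unfolding cox_length_def
proof (rule Least_equality)
  show "\<exists>v\<in>lists (Btilde_gens n). Btilde_elt n v = Btilde_elt n u \<and> length v = length u"
    using assms(2) by blast
next
  fix k assume "\<exists>v\<in>lists (Btilde_gens n). Btilde_elt n v = Btilde_elt n u \<and> length v = k"
  then obtain v where v: "v \<in> lists (Btilde_gens n)" "Btilde_elt n v = Btilde_elt n u" "length v = k"
    by blast
  have "eqv n v u" using v(2) unfolding cox_elt_eq_iff[OF v(1)] .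
  then have "path n v = path n u" by (rule fold_gact_eqv[OF _ assms(1)])
  from inversions_le[OF v(1) assms(1), unfolded this] show "length u \<le> k"
    using lexmin_path_inversions[OF assms(2,1,3)] v(3) by linarith
qed

lemma lexmin_path_right_lex_min:
  assumes "n \<ge> 3" "u \<in> lists (Btilde_gens n)" "lexmin_path n (period n) base_point u"
  shows "reduced (Btilde_gens n) (Btilde_matrix n) u"
    and "right_lex_min (Btilde_gens n) (Btilde_matrix n) u"
    and "affine_length n (Btilde_elt n u) = count_list u (n + 1)"
proof -
  note len = lexmin_path_length[OF assms]
  show red: "reduced (Btilde_gens n) (Btilde_matrix n) u"
    using assms(2) len by (simp add: reduced_def reduced_expr_def)
  have expr: "v \<in> lists (Btilde_gens n)" "path n v = path n u" "length v = length u"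
    if "reduced_expr (Btilde_gens n) (Btilde_matrix n) v (Btilde_elt n u)" for v
  proof -
    show v: "v \<in> lists (Btilde_gens n)" and "length v = length u"
      using that len by (auto simp: reduced_expr_def)
    have "Btilde_elt n v = Btilde_elt n u" using that by (simp add: reduced_expr_def)
    then have "eqv n v u" unfolding cox_elt_eq_iff[OF v] .
    then show "path n v = path n u" by (rule fold_gact_eqv[OF _ assms(1)])
  qed
  show "right_lex_min (Btilde_gens n) (Btilde_matrix n) u"
    unfolding right_lex_min_def
  proof (intro conjI allI impI red)
    fix v assume "reduced_expr (Btilde_gens n) (Btilde_matrix n) v (Btilde_elt n u)"
    from expr[OF this] show "v = u \<or> (rev u, rev v) \<in> lexord {(a, b). a < b}"
      by (intro lexmin_path_lex[OF assms])
  qed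
  have count: "count_list v (n + 1) = count_list u (n + 1)"
    if "reduced_expr (Btilde_gens n) (Btilde_matrix n) v (Btilde_elt n u)" for v
    using inversions_le[OF expr(1)[OF that] assms(1)] inversions_le[OF assms(2,1)]
      lexmin_path_inversions[OF assms(2,1,3)] expr(3)[OF that]
    unfolding expr(2)[OF that] by linarith
  show "affine_length n (Btilde_elt n u) = count_list u (n + 1)"
    unfolding affine_length_def
    by (rule the_equality) (use count red[unfolded reduced_def] in blast)+
qed

subsection \<open>Paths of block words\<close>

text \<open>A position \<open>p\<close> stands for the signed unit vector \<open>\<plusminus>e\<close> of index \<open>\<bar>p\<bar>\<close>; the word \<open>\<langle>j, m]\<close> with
  \<open>j = label p\<close> maps the last unit vector to it.\<close>

definition positions :: "nat \<Rightarrow> int set" where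
  "positions m = {- int m..int m} - {0}"

definition coset_word :: "int \<Rightarrow> nat \<Rightarrow> nat list" where
  "coset_word p m =
    (if p \<ge> 1 then [nat p..<m + 1]
     else if p = -1 then 0 # [2..<m + 1]
     else rev [2..<nat (- p)] @ [1, 0] @ [2..<m + 1])"

text \<open>The word \<open>\<langle>-i, k]\<close> starts with letter \<open>i\<close> and so picks
  up coordinate \<open>i + 1\<close>: hence the shift by one. Position \<open>-1\<close> keeps its
  name, and \<open>-2\<close> gets the label 0.\<close>

definition label :: "int \<Rightarrow> int" where
  "label p = (if p \<ge> -1 then p else if p = -2 then 0 else p + 1)"

lemma bracket_label: "p \<noteq> 0 \<Longrightarrow> bracket (label p) m = coset_word p m"
  by (auto simp: bracket_def label_def coset_word_def nat_add_distrib[symmetric] Suc_nat_eq_nat_zadd1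
      simp flip: numeral_2_eq_2 intro!: arg_cong[of _ _ nat])

lemma fold_gact_up:
  assumes "1 \<le> a" "a \<le> n + 1"
  shows "fold (gact n M) [a..<n + 1] q =
    (\<lambda>i. if a \<le> i \<and> i \<le> n then q (i + 1) else if i = n + 1 then q a else q i)"
  using assms
proof (induction "n + 1 - a" arbitrary: a q)
  case 0
  then show ?case by (auto simp: fun_eq_iff)
next
  case (Suc k)
  then have "[a..<n + 1] = a # [a + 1..<n + 1]" by (simp add: upt_conv_Cons del: upt_Suc)
  then have "fold (gact n M) [a..<n + 1] q = fold (gact n M) [a + 1..<n + 1] (gact n M a q)"
    by (simp del: upt_Suc)
  also have "\<dots> = (\<lambda>i. if a + 1 \<le> i \<and> i \<le> n then gact n M a q (i + 1)
      else if i = n + 1 then gact n M a q (a + 1) else gact n M a q i)"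
    by (rule Suc.hyps(1)) (use Suc.hyps(2) in simp_all)
  also have "\<dots> = (\<lambda>i. if a \<le> i \<and> i \<le> n then q (i + 1) else if i = n + 1 then q a else q i)"
    using Suc.hyps(2) Suc.prems(1) by (auto simp: fun_eq_iff gact_def)
  finally show ?case .
qed

lemma fold_gact_down:
  assumes "2 \<le> a" "a \<le> n + 1"
  shows "fold (gact n M) (rev [2..<a]) q =
    (\<lambda>i. if i = 2 then q a else if 3 \<le> i \<and> i \<le> a then q (i - 1) else q i)"
  using assms
proof (induction a arbitrary: q rule: dec_induct)
  case base
  then show ?case by (auto simp: fun_eq_iff)
next
  case (step a)
  then have "fold (gact n M) (rev [2..<Suc a]) q = fold (gact n M) (rev [2..<a]) (gact n M a q)"
    by simp
  also have "\<dots> = (\<lambda>i. if i = 2 then gact n M a q a else if 3 \<le> i \<and> i \<le> a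
      then gact n M a q (i - 1) else gact n M a q i)"
    using step by simp
  also have "\<dots> = (\<lambda>i. if i = 2 then q (Suc a) else if 3 \<le> i \<and> i \<le> Suc a then q (i - 1) else q i)"
    using step(1,2,4) by (auto simp: fun_eq_iff gact_def)
  finally show ?case .
qed

text \<open>The coordinate of index \<open>\<bar>p\<bar>\<close>, negated if \<open>p < 0\<close>,
  moves to the end and the later ones close the gap. For negative \<open>p\<close> one more
  coordinate is negated, since type D changes signs in pairs; it ends up at index 1.\<close>

definition shift :: "nat \<Rightarrow> int \<Rightarrow> (nat \<Rightarrow> int) \<Rightarrow> nat \<Rightarrow> int" where
  "shift n p q =
    (if p > 0 then (\<lambda>i. if nat p \<le> i \<and> i \<le> n then q (i + 1) else if i = n + 1 then q (nat p) else q i)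
     else if p = -1 then (\<lambda>i. if i = 1 then - q 2 else if 2 \<le> i \<and> i \<le> n then q (i + 1)
        else if i = n + 1 then - q 1 else q i)
     else (\<lambda>i. if i = 1 then - q 1 else if nat (- p) \<le> i \<and> i \<le> n then q (i + 1)
        else if i = n + 1 then - q (nat (- p)) else q i))"

lemma fold_gact_coset_word:
  assumes "p \<in> positions (n + 1)" "n \<ge> 3"
  shows "fold (gact n M) (coset_word p n) q = shift n p q"
proof -
  consider "p \<ge> 1" | "p = -1" | "p \<le> -2" using assms(1) by (fastforce simp: positions_def)
  then show ?thesis
  proof cases
    case 1
    then show ?thesis using assms fold_gact_up[of "nat p" n M q]
      by (auto simp: coset_word_def shift_def positions_def)
  next
    case 2
    then show ?thesis using assms(2) fold_gact_up[of 2 n M "gact n M 0 q"]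
      by (simp add: coset_word_def shift_def fun_eq_iff) (auto simp: gact_def)
  next
    case 3
    define k where "k = nat (- p)"
    have k: "2 \<le> k" "k \<le> n + 1" "p = - int k" using 3 assms(1) by (auto simp: k_def positions_def)
    define q1 where "q1 = fold (gact n M) (rev [2..<k]) q"
    define q2 where "q2 = gact n M 0 (gact n M 1 q1)"
    have q1: "q1 i = (if i = 2 then q k else if 3 \<le> i \<and> i \<le> k then q (i - 1) else q i)" for i
      unfolding q1_def fold_gact_down[OF k(1,2)] ..
    have q2: "q2 i = (if i = 1 then - q1 1 else if i = 2 then - q1 2 else q1 i)" for i
      using assms(2) by (simp add: q2_def gact_def numeral_2_eq_2)
    have "fold (gact n M) (coset_word p n) q = fold (gact n M) [2..<n + 1] q2"
      using k by (simp add: coset_word_def q1_def q2_def del: upt_Suc)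
    also have "\<dots> = (\<lambda>i. if 2 \<le> i \<and> i \<le> n then q2 (i + 1) else if i = n + 1 then q2 2 else q2 i)"
      by (rule fold_gact_up) (use assms(2) in simp_all)
    also have "\<dots> = shift n p q"
      using assms(2) k by (auto simp: shift_def fun_eq_iff q1 q2)
    finally show ?thesis .
  qed
qed

section \<open>Coset words as lex-min paths\<close>

text \<open>The open Weyl chamber of type D; its first coordinate may be negative.\<close>

definition dominant :: "nat \<Rightarrow> (nat \<Rightarrow> int) \<Rightarrow> bool" where
  "dominant n q \<longleftrightarrow> (\<forall>i j. 1 \<le> i \<longrightarrow> i < j \<longrightarrow> j \<le> n + 1 \<longrightarrow> q i < q j \<and> 0 < q i + q j)"

lemma dominantD:
  "dominant n q \<Longrightarrow> 1 \<le> i \<Longrightarrow> i < j \<Longrightarrow> j \<le> n + 1 \<Longrightarrow> q i < q j"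
  "dominant n q \<Longrightarrow> 1 \<le> i \<Longrightarrow> i < j \<Longrightarrow> j \<le> n + 1 \<Longrightarrow> 0 < q i + q j"
  by (auto simp: dominant_def)

lemma dominant_wall: "dominant n q \<Longrightarrow> n \<ge> 3 \<Longrightarrow> r \<le> n \<Longrightarrow> wall n M r q > 0"
  by (auto simp: wall_def dominant_def)

text \<open>The travelling coordinate sits at \<open>a\<close>, below all later ones, while the
  others are dominant among themselves. For \<open>a \<ge> 2\<close> nothing relates it to the
  earlier coordinates, because it may just have been negated; for \<open>a = 1\<close> the sum
  condition keeps wall 0 positive after the swap.\<close>

lemma lexmin_path_up:
  assumes "1 \<le> a" "a \<le> n + 1" "n \<ge> 3"
    and "\<And>i. a < i \<Longrightarrow> i \<le> n + 1 \<Longrightarrow> q a < q i"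
    and "\<And>i j. 1 \<le> i \<Longrightarrow> i < j \<Longrightarrow> j \<le> n + 1 \<Longrightarrow> i \<noteq> a \<Longrightarrow> j \<noteq> a \<Longrightarrow> q i < q j \<and> 0 < q i + q j"
    and "a = 1 \<Longrightarrow> 0 < q 1 + q 2"
  shows "lexmin_path n M q [a..<n + 1]"
  using assms
proof (induction "n + 1 - a" arbitrary: a q)
  case (Suc k)
  define q' where "q' = gact n M a q"
  have a: "1 \<le> a" "a \<le> n" using Suc.hyps(2) Suc.prems(1) by simp_all
  have q': "q' i = (if i = a then q (a + 1) else if i = a + 1 then q a else q i)" for i
    using a by (simp add: q'_def gact_def)
  note above = Suc.prems(4) and rest = Suc.prems(5)
  have up: "[a..<n + 1] = a # [a + 1..<n + 1]" using a by (simp add: upt_conv_Cons del: upt_Suc)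
  have w: "wall n M a q > 0" using a above[of "a + 1"] by (simp add: wall_def)
  have w': "wall n M r q' > 0" if r: "r < a" for r
  proof (cases "r = 0")
    case True
    then show ?thesis using Suc.prems(3,6) a rest[of 1 2] rest[of 1 3]
      by (cases "a = 1"; cases "a = 2") (auto simp: wall_def q' numeral_3_eq_3 numeral_2_eq_2)
  next
    case False
    then show ?thesis using r a rest[of r "r + 1"] rest[of r "r + 2"]
      by (auto simp: wall_def q')
  qed
  have "lexmin_path n M q' [a + 1..<n + 1]"
  proof (rule Suc.hyps(1))
    show "k = n + 1 - (a + 1)" using Suc.hyps(2) by simp
    fix i assume "a + 1 < i" "i \<le> n + 1"
    then show "q' (a + 1) < q' i" using above[of i] by (simp add: q')
  next
    fix i j assume ij: "1 \<le> i" "i < j" "j \<le> n + 1" "i \<noteq> a + 1" "j \<noteq> a + 1"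
    show "q' i < q' j \<and> 0 < q' i + q' j"
      using ij a rest[of i j] rest[of "a + 1" j] rest[of i "a + 1"] by (auto simp: q')
  qed (use a Suc.prems(3) in auto)
  then show ?case using w w' unfolding up lexmin_path.simps q'_def by blast
qed simp

text \<open>The coordinate at \<open>a\<close> travels down to index 2, the letters 1 and 0 negate
  it together with the first one, and it travels up to the end. It is compared only with earlier
  coordinates and through sums, which is what survives each downward swap.\<close>

lemma lexmin_path_down:
  assumes "2 \<le> a" "a \<le> n + 1" "n \<ge> 3"
    and "\<And>i. 1 \<le> i \<Longrightarrow> i < a \<Longrightarrow> q i < q a"
    and "\<And>i. 1 \<le> i \<Longrightarrow> i \<le> n + 1 \<Longrightarrow> i \<noteq> a \<Longrightarrow> 0 < q i + q a"
    and "\<And>i j. 1 \<le> i \<Longrightarrow> i < j \<Longrightarrow> j \<le> n + 1 \<Longrightarrow> i \<noteq> a \<Longrightarrow> j \<noteq> a \<Longrightarrow> q i < q j \<and> 0 < q i + q j"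
  shows "lexmin_path n M q (rev [2..<a] @ [1, 0] @ [2..<n + 1])"
  using assms
proof (induction a arbitrary: q rule: dec_induct)
  case base
  define q1 where "q1 = gact n M 1 q"
  define q2 where "q2 = gact n M 0 q1"
  have q1: "q1 1 = q 2" "q1 2 = q 1" "\<And>i. i \<notin> {1, 2} \<Longrightarrow> q1 i = q i"
    using base(2) by (simp_all add: q1_def gact_def numeral_2_eq_2)
  have q2: "q2 1 = - q 1" "q2 2 = - q 2" "\<And>i. i \<notin> {1, 2} \<Longrightarrow> q2 i = q i"
    using q1 by (simp_all add: q2_def gact_def)
  \<comment> \<open>The second inequality serves twice: it makes 1 the least descent after its step,
    and it lets the letter 0 cross outwards. This is why 0 stands to the right of 1, although the
    two commute.\<close>
  have w: "wall n M 1 q > 0" "wall n M 0 q1 > 0"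
    using base(2) base(3)[of 1] base(4)[of 1] q1(1,2)
    by (simp_all add: wall_def numeral_2_eq_2)
  have "lexmin_path n M q2 [2..<n + 1]"
  proof (rule lexmin_path_up)
    fix i assume "2 < i" "i \<le> n + 1"
    then show "q2 2 < q2 i" using base(4)[of i] q2 by simp
  next
    fix i j :: nat assume ij: "1 \<le> i" "i < j" "j \<le> n + 1" "i \<noteq> 2" "j \<noteq> 2"
    have "j \<notin> {1, 2}" using ij by auto
    then show "q2 i < q2 j \<and> 0 < q2 i + q2 j"
      using base(5)[OF ij] q2 ij by (cases "i = 1") auto
  qed (use base(2) in auto)
  then show ?case using w by (simp add: q1_def q2_def del: upt_Suc)
next
  case (step a)
  define q' where "q' = gact n M a q"
  have a: "2 \<le> a" "a \<le> n" using step.hyps step.prems(1) by simp_all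
  have q': "q' i = (if i = a then q (a + 1) else if i = a + 1 then q a else q i)" for i
    using a by (simp add: q'_def gact_def)
  note below = step.prems(3) and pos = step.prems(4) and rest = step.prems(5)
  have w: "wall n M a q > 0" using a below[of a] by (simp add: wall_def)
  have w': "wall n M r q' > 0" if r: "r < a" for r
  proof (cases "r = 0")
    case True
    then show ?thesis using a rest[of 1 2] pos[of 1]
      by (cases "a = 2") (auto simp: wall_def q' numeral_3_eq_3 numeral_2_eq_2)
  next
    case False
    then show ?thesis using r a rest[of r "r + 1"] below[of r]
      by (auto simp: wall_def q')
  qed
  have "lexmin_path n M q' (rev [2..<a] @ [1, 0] @ [2..<n + 1])"
  proof (rule step.IH)
    fix i assume "1 \<le> i" "i < a"
    then show "q' i < q' a" using below[of i] by (simp add: q')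
  next
    fix i assume "1 \<le> i" "i \<le> n + 1" "i \<noteq> a"
    then show "0 < q' i + q' a" using pos[of i] pos[of a] a by (auto simp: q')
  next
    fix i j assume ij: "1 \<le> i" "i < j" "j \<le> n + 1" "i \<noteq> a" "j \<noteq> a"
    show "q' i < q' j \<and> 0 < q' i + q' j"
      using ij a rest[of i j] rest[of a j] rest[of i a] by (auto simp: q')
  qed (use a step.prems(2) in auto)
  then show ?case using w w' a by (simp add: q'_def del: upt_Suc) (simp add: q'_def)
qed

lemma lexmin_path_coset_word:
  assumes "dominant n q" "n \<ge> 3" "p \<in> positions (n + 1)"
  shows "lexmin_path n M q (coset_word p n)"
proof -
  consider "p \<ge> 1" | "p = -1" | "p \<le> -2" using assms(3) by (fastforce simp: positions_def)
  then show ?thesis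
  proof cases
    case 1
    have "lexmin_path n M q [nat p..<n + 1]"
      by (rule lexmin_path_up) (use 1 assms in \<open>auto simp: positions_def dominant_def\<close>)
    then show ?thesis using 1 by (simp add: coset_word_def del: upt_Suc)
  next
    case 2
    define q' where "q' = gact n M 0 q"
    have q': "q' 1 = - q 2" "q' 2 = - q 1" "\<And>i. i \<notin> {1, 2} \<Longrightarrow> q' i = q i"
      by (simp_all add: q'_def gact_def)
    have "lexmin_path n M q' [2..<n + 1]"
    proof (rule lexmin_path_up)
      fix i assume "2 < i" "i \<le> n + 1"
      then show "q' 2 < q' i" using dominantD(2)[OF assms(1), of 1 i] q' by simp
    next
      fix i j :: nat assume ij: "1 \<le> i" "i < j" "j \<le> n + 1" "i \<noteq> 2" "j \<noteq> 2"
      have "j \<notin> {1, 2}" using ij by auto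
      then show "q' i < q' j \<and> 0 < q' i + q' j"
        using dominantD[OF assms(1) ij(1,2,3)] dominantD[OF assms(1) _ _ ij(3), of 2] q' ij
        by (cases "i = 1") auto
    qed (use assms(2) in auto)
    moreover have "wall n M 0 q > 0" by (rule dominant_wall[OF assms(1,2)]) simp
    ultimately show ?thesis using 2 by (simp add: coset_word_def q'_def del: upt_Suc)
  next
    case 3
    have "lexmin_path n M q (rev [2..<nat (- p)] @ [1, 0] @ [2..<n + 1])"
    proof (rule lexmin_path_down)
      fix i assume "1 \<le> i" "i \<le> n + 1" "i \<noteq> nat (- p)"
      moreover have "1 \<le> nat (- p)" "nat (- p) \<le> n + 1"
        using 3 assms(3) by (auto simp: positions_def)
      ultimately show "0 < q i + q (nat (- p))"
        using dominantD(2)[OF assms(1), of i "nat (- p)"] dominantD(2)[OF assms(1), of "nat (- p)" i]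
        by (cases "i < nat (- p)") (simp_all add: add.commute)
    qed (use 3 assms in \<open>auto simp: positions_def dominant_def\<close>)
    then show ?thesis using 3 by (simp add: coset_word_def del: upt_Suc)
  qed
qed

section \<open>The effect of a block on a dominant point\<close>

definition step :: "nat \<Rightarrow> int \<Rightarrow> int \<Rightarrow> (nat \<Rightarrow> int) \<Rightarrow> nat \<Rightarrow> int" where
  "step n M p q = gact n M (n + 1) (shift n p q)"

text \<open>Minus the coordinate that the coset word brings to index \<open>n + 1\<close>, so that
  the closing letter turns it into \<open>M + entry p q\<close>.\<close>

definition entry :: "int \<Rightarrow> (nat \<Rightarrow> int) \<Rightarrow> int" where
  "entry p q = (if p > 0 then - q (nat p) else q (nat (- p)))"

text \<open>The conditions (a)--(c) for consecutive blocks, in terms of positions.\<close>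

definition follows :: "int \<Rightarrow> int \<Rightarrow> bool" where
  "follows p p' \<longleftrightarrow>
    (if p = -1 then p' = 1 \<or> p' \<le> -2 else if p > 0 then p' < p else p' \<le> p)"

definition blocks :: "nat \<Rightarrow> int list \<Rightarrow> nat list" where
  "blocks n ps = concat (map (\<lambda>p. coset_word p n @ [n + 1]) ps)"

lemma fold_gact_block:
  assumes "p \<in> positions (n + 1)" "n \<ge> 3"
  shows "fold (gact n M) (coset_word p n @ [n + 1]) q = step n M p q"
  using fold_gact_coset_word[OF assms] by (simp add: step_def)

lemma step_simps:
  "p \<ge> 1 \<Longrightarrow> p \<le> int n + 1 \<Longrightarrow> step n M p q i =
    (if nat p \<le> i \<and> i \<le> n then q (i + 1) else if i = n + 1 then M - q (nat p) else q i)"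
  "n \<ge> 3 \<Longrightarrow> step n M (-1) q i = (if i = 1 then - q 2 else if 2 \<le> i \<and> i \<le> n then q (i + 1)
     else if i = n + 1 then M + q 1 else q i)"
  "n \<ge> 3 \<Longrightarrow> 2 \<le> k \<Longrightarrow> k \<le> n + 1 \<Longrightarrow> step n M (- int k) q i =
    (if i = 1 then - q 1 else if k \<le> i \<and> i \<le> n then q (i + 1)
     else if i = n + 1 then M + q k else q i)"
  by (auto simp: step_def shift_def gact_def)

lemma positions_cases:
  assumes "p \<in> positions m"
  obtains k where "1 \<le> k" "k \<le> m" "p = int k" | "p = -1" "1 \<le> m"
    | k where "2 \<le> k" "k \<le> m" "p = - int k"
proof -
  consider "p \<ge> 1" | "p = -1" | "p \<le> -2" using assms by (fastforce simp: positions_def)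
  then show thesis
  proof cases
    case 1 then show thesis using that(1)[of "nat p"] assms by (auto simp: positions_def)
  next
    case 2 then show thesis using that(2) assms by (auto simp: positions_def)
  next
    case 3 then show thesis using that(3)[of "nat (- p)"] assms by (auto simp: positions_def)
  qed
qed

text \<open>The first condition makes the closing letter cross its wall outwards; the second makes
  the new last coordinate exceed all others in absolute value, as dominance after the block
  demands.\<close>

definition safe :: "nat \<Rightarrow> int \<Rightarrow> int \<Rightarrow> (nat \<Rightarrow> int) \<Rightarrow> bool" where
  "safe n M p q \<longleftrightarrow> M + 2 * entry p q > 0 \<and>
    (\<forall>i. 1 \<le> i \<longrightarrow> i \<le> n + 1 \<longrightarrow> i \<noteq> nat \<bar>p\<bar> \<longrightarrow> \<bar>q i\<bar> < M + entry p q)"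

lemma step_last:
  assumes "p \<in> positions (n + 1)" "n \<ge> 3"
  shows "step n M p q (n + 1) = M + entry p q"
  using assms by (auto simp: step_def shift_def gact_def entry_def positions_def)

lemma step_other:
  assumes "p \<in> positions (n + 1)" "n \<ge> 3" "1 \<le> i" "i \<le> n"
  obtains j where "1 \<le> j" "j \<le> n + 1" "j \<noteq> nat \<bar>p\<bar>" "\<bar>step n M p q i\<bar> = \<bar>q j\<bar>"
    "i \<ge> 2 \<Longrightarrow> step n M p q i = q j" "i \<ge> 2 \<Longrightarrow> j \<ge> 2"
  using assms(1)
proof (cases rule: positions_cases)
  case (1 k)
  then show ?thesis using assms that[of "if k \<le> i then i + 1 else i"] by (auto simp: step_simps)
next
  case 2
  then show ?thesis using assms that[of "i + 1"] by (auto simp: step_simps numeral_2_eq_2)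
next
  case (3 k)
  then show ?thesis using assms that[of "if k \<le> i then i + 1 else i"] by (auto simp: step_simps)
qed

lemma dominant_step:
  assumes "dominant n q" "n \<ge> 3" "p \<in> positions (n + 1)" "safe n M p q"
  shows "dominant n (step n M p q)"
proof -
  let ?q = "step n M p q"
  have less: "\<bar>?q i\<bar> < ?q (n + 1)" if "1 \<le> i" "i \<le> n" for i
    using step_other[OF assms(3,2) that, of M q] step_last[OF assms(3,2), of M q] assms(4)
    unfolding safe_def by metis
  have "?q i < ?q j \<and> 0 < ?q i + ?q j" if ij: "1 \<le> i" "i < j" "j \<le> n + 1" for i j
  proof (cases "j = n + 1")
    case True
    then show ?thesis using less[of i] ij by auto
  next
    case False
    then have j: "j \<le> n" using ij by simp
    note d = assms(1)[unfolded dominant_def, rule_format]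
    show ?thesis using assms(3)
    proof (cases rule: positions_cases)
      case (1 k)
      then show ?thesis using ij j d[of i j] d[of i "j + 1"] d[of "i + 1" "j + 1"]
        by (auto simp: step_simps)
    next
      case 2
      then show ?thesis using ij j assms(2) d[of 2 "j + 1"] d[of "i + 1" "j + 1"]
        by (auto simp: step_simps)
    next
      case (3 k)
      then show ?thesis using ij j assms(2) d[of i j] d[of i "j + 1"] d[of "i + 1" "j + 1"]
        by (auto simp: step_simps)
    qed
  qed
  then show ?thesis unfolding dominant_def by blast
qed

text \<open>The next block picks either a coordinate that was already present, where dominance gives
  the inequality, or (for \<open>p' = - (n + 1)\<close>) the one just created, which exceeds the old
  entry by \<open>M\<close>. The relation \<open>follows\<close> excludes the other choices.\<close>

lemma entry_step_less:
  assumes "dominant n q" "n \<ge> 3" "p \<in> positions (n + 1)" "p' \<in> positions (n + 1)"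
    and "follows p p'" "M > 0"
  shows "entry p q < entry p' (step n M p q)"
proof -
  note d = assms(1)[unfolded dominant_def, rule_format]
  show ?thesis using assms(3)
  proof (cases rule: positions_cases)
    case (1 k)
    show ?thesis using assms(4)
    proof (cases rule: positions_cases)
      case (1 k')
      then have "k' < k" using \<open>p = int k\<close> \<open>1 \<le> k\<close> assms(5) by (auto simp: follows_def)
      then show ?thesis using 1 \<open>k \<le> n + 1\<close> \<open>p = int k\<close> d[of k' k]
        by (simp add: step_simps entry_def)
    next
      case 2
      then show ?thesis using 1 assms(2) d[of 1 2] d[of 1 k]
        by (cases "k = 1") (auto simp: step_simps entry_def numeral_2_eq_2)
    next
      case (3 k')
      show ?thesis
      proof (cases "k' = n + 1")
        case True
        have "entry p' (step n M p q) = step n M p q k'" using 3 by (simp add: entry_def)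
        moreover have "step n M p q k' = M - q k" using True 1 by (simp add: step_simps)
        moreover have "entry p q = - q k" using 1 by (simp add: entry_def)
        ultimately show ?thesis using assms(6) by simp
      next
        case False
        then show ?thesis using 3 1 d[of k' k] d[of k "k' + 1"]
          by (auto simp: step_simps entry_def)
      qed
    qed
  next
    case 2
    show ?thesis using assms(4)
    proof (cases rule: positions_cases)
      case (1 k')
      then have "k' = 1" using 2 assms(5) by (auto simp: follows_def)
      then show ?thesis using 1 2 assms(2) d[of 1 2] by (simp add: step_simps entry_def)
    next
      case 2
      then show ?thesis using \<open>p = -1\<close> assms(5) by (auto simp: follows_def)
    next
      case (3 k')
      then show ?thesis using 2 assms(2,6) d[of 1 "k' + 1"]
        by (cases "k' = n + 1") (auto simp: step_simps entry_def)
    qed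
  next
    case (3 k)
    have "p' \<le> p" using 3 assms(5) by (auto simp: follows_def split: if_splits)
    then obtain k' where k': "p' = - int k'" "k \<le> k'" "k' \<le> n + 1"
      using 3 assms(4) by (intro that[of "nat (- p')"]) (auto simp: positions_def)
    then show ?thesis using 3 assms(2,6) d[of k "k' + 1"]
      by (cases "k' = n + 1") (auto simp: step_simps entry_def)
  qed
qed

text \<open>After the block every coordinate is at most \<open>M + entry p q\<close> in absolute
  value, and the next entry is strictly larger than \<open>entry p q\<close>.\<close>

lemma safe_step:
  assumes "dominant n q" "n \<ge> 3" "p \<in> positions (n + 1)" "p' \<in> positions (n + 1)"
    and "follows p p'" "M > 0" "safe n M p q"
  shows "safe n M p' (step n M p q)"
proof -
  have less: "entry p q < entry p' (step n M p q)" by (rule entry_step_less[OF assms(1-6)])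
  have "\<bar>step n M p q i\<bar> \<le> M + entry p q" if "1 \<le> i" "i \<le> n + 1" for i
  proof (cases "i = n + 1")
    case True
    then show ?thesis using step_last[OF assms(3,2), of M q] assms(6,7) by (auto simp: safe_def)
  next
    case False
    then have "i \<le> n" using that by simp
    then show ?thesis
      using step_other[OF assms(3,2) that(1), of M q] assms(7) unfolding safe_def
      by (metis order_less_imp_le)
  qed
  then have "\<bar>step n M p q i\<bar> < M + entry p' (step n M p q)" if "1 \<le> i" "i \<le> n + 1" for i
    using that less by fastforce
  then show ?thesis using less assms(7) unfolding safe_def by auto
qed

lemma lexmin_path_blocks:
  assumes "n \<ge> 3" "M > 0" "dominant n q" "set ps \<subseteq> positions (n + 1)" "successively follows ps"
    and "ps \<noteq> [] \<Longrightarrow> safe n M (hd ps) q"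
  shows "lexmin_path n M q (blocks n ps)"
  using assms(3-)
proof (induction ps arbitrary: q)
  case (Cons p ps)
  have p: "p \<in> positions (n + 1)" "safe n M p q" using Cons.prems by auto
  have q': "dominant n (step n M p q)"
    by (rule dominant_step[OF Cons.prems(1) assms(1) p])
  have "lexmin_path n M (step n M p q) (blocks n ps)"
  proof (rule Cons.IH[OF q'])
    show "set ps \<subseteq> positions (n + 1)" "successively follows ps"
      using Cons.prems by (auto simp: successively_Cons)
    show "safe n M (hd ps) (step n M p q)" if "ps \<noteq> []"
      using that Cons.prems p assms(1,2)
      by (intro safe_step) (auto simp: successively_Cons)
  qed
  moreover have "lexmin_path n M q (coset_word p n)"
    by (rule lexmin_path_coset_word[OF Cons.prems(1) assms(1) p(1)])
  moreover have "wall n M (n + 1) (shift n p q) > 0"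
  proof -
    have "shift n p q (n + 1) = - entry p q"
      using step_last[OF p(1) assms(1), of M q] by (simp add: step_def gact_def)
    then show ?thesis using p(2) by (simp add: wall_def safe_def)
  qed
  moreover have "wall n M r (step n M p q) > 0" if "r < n + 1" for r
    using dominant_wall[OF q' assms(1)] that by simp
  ultimately show ?case
    using fold_gact_coset_word[OF p(1) assms(1), of M q]
    by (simp add: blocks_def lexmin_path_append step_def)
qed (simp add: blocks_def)

lemma lexmin_path_blocks_base:
  assumes "n \<ge> 3" "set ps \<subseteq> positions (n + 1)" "successively follows ps"
  shows "lexmin_path n (period n) base_point (blocks n ps)"
proof (rule lexmin_path_blocks[OF assms(1) _ _ assms(2,3)])
  show "dominant n base_point" by (auto simp: dominant_def base_point_def)
  \<comment> \<open>The coordinates lie between 0 and \<open>n\<close>, so \<open>M + entry\<close>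
    is at least \<open>n + 1\<close>: any first block is safe.\<close>
  show "safe n (period n) (hd ps) base_point" if "ps \<noteq> []"
  proof -
    have "hd ps \<in> positions (n + 1)" using that assms(2) by auto
    then show ?thesis by (auto simp: safe_def base_point_def entry_def positions_def)
  qed
qed simp

lemma coset_word_letters:
  assumes "p \<in> positions (m + 1)" "m \<ge> 1"
  shows "set (coset_word p m) \<subseteq> {0..m}"
  using assms by (auto simp: coset_word_def positions_def)

subsection \<open>Block words and lattice points\<close>

definition taxicab :: "nat \<Rightarrow> (nat \<Rightarrow> int) \<Rightarrow> int" where
  "taxicab n v = (\<Sum>i\<in>{1..n + 1}. \<bar>v i\<bar>)"

lemma taxicab_fold_gact:
  assumes "n \<ge> 3" "set u \<subseteq> {0..n}"
  shows "taxicab n (fold (gact n M) u v) = taxicab n v"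
  using assms(2)
proof (induction u arbitrary: v)
  case (Cons s u)
  have "taxicab n (gact n M s v) = taxicab n v"
    unfolding taxicab_def by (rule sum_gact) (use assms(1) Cons.prems in auto)
  then show ?case using Cons by simp
qed simp

text \<open>The coset word brings the positive integer \<open>- entry p v\<close> to the end, and
  the closing letter replaces it by \<open>1 + entry p v\<close>, whose absolute value is one less.
  The norm thus terminates the greedy procedure.\<close>

lemma taxicab_step:
  assumes "n \<ge> 3" "p \<in> positions (n + 1)" "entry p v < 0"
  shows "taxicab n (step n 1 p v) = taxicab n v - 1"
proof -
  have last: "shift n p v (n + 1) = - entry p v"
    using step_last[OF assms(2,1), of 1 v] by (simp add: step_def gact_def)
  have "taxicab n v = taxicab n (shift n p v)"
    using taxicab_fold_gact[OF assms(1) coset_word_letters[OF assms(2)]]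
      fold_gact_coset_word[OF assms(2,1)] assms(1) by simp
  moreover have "(\<Sum>i\<in>{1..n}. \<bar>step n 1 p v i\<bar>) = (\<Sum>i\<in>{1..n}. \<bar>shift n p v i\<bar>)"
    by (rule sum.cong) (auto simp: step_def gact_def)
  moreover have "{1..n + 1} = insert (n + 1) {1..n}" by auto
  ultimately show ?thesis
    using last step_last[OF assms(2,1), of 1 v] assms(3) by (simp add: taxicab_def)
qed

section \<open>The greedy choice of the first block\<close>

definition leading :: "nat \<Rightarrow> (nat \<Rightarrow> int) \<Rightarrow> int \<Rightarrow> bool" where
  "leading n v p \<longleftrightarrow> p \<in> positions (n + 1) \<and>
    (if p > 0 then v (nat p) > 0 \<and> (\<forall>i. nat p < i \<longrightarrow> i \<le> n + 1 \<longrightarrow> v i \<le> 0)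
     else (\<forall>i. 1 \<le> i \<longrightarrow> i \<le> n + 1 \<longrightarrow> v i \<le> 0) \<and> v (nat (- p)) < 0 \<and>
       (\<forall>i. 1 \<le> i \<longrightarrow> i < nat (- p) \<longrightarrow> v i = 0))"

definition vanishes :: "nat \<Rightarrow> (nat \<Rightarrow> int) \<Rightarrow> bool" where
  "vanishes n v \<longleftrightarrow> (\<forall>i. 1 \<le> i \<longrightarrow> i \<le> n + 1 \<longrightarrow> v i = 0)"

lemma leading_pos_iff:
  "1 \<le> k \<Longrightarrow> k \<le> n + 1 \<Longrightarrow> leading n v (int k) \<longleftrightarrow>
    v k > 0 \<and> (\<forall>i. k < i \<longrightarrow> i \<le> n + 1 \<longrightarrow> v i \<le> 0)"
  by (auto simp: leading_def positions_def)

lemma leading_neg_iff: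
  "1 \<le> k \<Longrightarrow> k \<le> n + 1 \<Longrightarrow> leading n v (- int k) \<longleftrightarrow>
    (\<forall>i. 1 \<le> i \<longrightarrow> i \<le> n + 1 \<longrightarrow> v i \<le> 0) \<and> v k < 0 \<and> (\<forall>i. 1 \<le> i \<longrightarrow> i < k \<longrightarrow> v i = 0)"
  by (auto simp: leading_def positions_def)

lemma leading_entry: "leading n v p \<Longrightarrow> entry p v < 0"
  by (auto simp: leading_def entry_def split: if_splits)

lemma positions_signed:
  assumes "p \<in> positions m"
  obtains k where "1 \<le> k" "k \<le> m" "p = int k \<or> p = - int k"
  using assms
proof (cases rule: positions_cases)
  case (1 k)
  then show ?thesis by (intro that[of k]) auto
next
  case 2
  then show ?thesis by (intro that[of 1]) auto
next
  case (3 k)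
  then show ?thesis by (intro that[of k]) auto
qed

lemma leading_unique:
  assumes "leading n v p" "leading n v p'"
  shows "p = p'"
proof -
  have pp': "p \<in> positions (n + 1)" "p' \<in> positions (n + 1)" using assms by (auto simp: leading_def)
  obtain k where k: "1 \<le> k" "k \<le> n + 1" "p = int k \<or> p = - int k"
    by (rule positions_signed[OF pp'(1)])
  obtain k' where k': "1 \<le> k'" "k' \<le> n + 1" "p' = int k' \<or> p' = - int k'"
    by (rule positions_signed[OF pp'(2)])
  consider "p = int k" "p' = int k'" | "p = int k" "p' = - int k'"
    | "p = - int k" "p' = int k'" | "p = - int k" "p' = - int k'"
    using k(3) k'(3) by blast
  then show ?thesis
  proof cases
    case 1
    then have "v k > 0" "v k' > 0" "\<not> k < k'" "\<not> k' < k"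
      using assms leading_pos_iff[OF k(1,2)] leading_pos_iff[OF k'(1,2)] k(2) k'(2) by force+
    then show ?thesis using 1 by simp
  next
    case 2
    then have "v k > 0" "v k \<le> 0"
      using assms leading_pos_iff[OF k(1,2)] leading_neg_iff[OF k'(1,2)] k(1,2) by auto
    then show ?thesis by simp
  next
    case 3
    then have "v k' > 0" "v k' \<le> 0"
      using assms leading_neg_iff[OF k(1,2)] leading_pos_iff[OF k'(1,2)] k'(1,2) by auto
    then show ?thesis by simp
  next
    case 4
    then have "v k < 0" "v k' < 0" "\<not> k < k'" "\<not> k' < k"
      using assms leading_neg_iff[OF k(1,2)] leading_neg_iff[OF k'(1,2)] k(1) k'(1) by force+
    then show ?thesis using 4 by simp
  qed
qed

lemma leading_not_vanishes:
  assumes "leading n v p"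
  shows "\<not> vanishes n v"
proof -
  have "p \<in> positions (n + 1)" using assms by (simp add: leading_def)
  then obtain k where "1 \<le> k" "k \<le> n + 1" "p = int k \<or> p = - int k"
    by (rule positions_signed)
  then have "v k \<noteq> 0" using assms leading_pos_iff[of k n v] leading_neg_iff[of k n v] by auto
  then show ?thesis using \<open>1 \<le> k\<close> \<open>k \<le> n + 1\<close> by (auto simp: vanishes_def)
qed

lemma leading_exists:
  assumes "\<not> vanishes n v"
  shows "\<exists>p. leading n v p"
proof (cases "\<exists>k. k \<in> {1..n + 1} \<and> v k > 0")
  case True
  then obtain k where k: "k \<in> {1..n + 1} \<and> v k > 0"
    "\<And>i. i \<in> {1..n + 1} \<and> v i > 0 \<Longrightarrow> i \<le> k"
    using Greatest_le_nat[of "\<lambda>k. k \<in> {1..n + 1} \<and> v k > 0" _ "n + 1"]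
      GreatestI_ex_nat[of "\<lambda>k. k \<in> {1..n + 1} \<and> v k > 0" "n + 1"] by auto
  have "v i \<le> 0" if "k < i" "i \<le> n + 1" for i
    using k(2)[of i] that by (cases "v i > 0") auto
  then have "leading n v (int k)" using k(1) by (subst leading_pos_iff) auto
  then show ?thesis ..
next
  case False
  have "\<exists>k. k \<in> {1..n + 1} \<and> v k \<noteq> 0" using assms by (auto simp: vanishes_def)
  then obtain k where k: "k \<in> {1..n + 1} \<and> v k \<noteq> 0"
    "\<And>i. i < k \<Longrightarrow> \<not> (i \<in> {1..n + 1} \<and> v i \<noteq> 0)"
    using exists_least_iff[of "\<lambda>k. k \<in> {1..n + 1} \<and> v k \<noteq> 0"] by blast
  have np: "v i \<le> 0" if "1 \<le> i" "i \<le> n + 1" for i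
  proof (rule ccontr)
    assume "\<not> v i \<le> 0"
    then show False using False that by (meson atLeastAtMost_iff linorder_not_le)
  qed
  have "v i = 0" if "1 \<le> i" "i < k" for i
  proof -
    have "i \<in> {1..n + 1}" using that k(1) by simp
    then show ?thesis using k(2)[OF that(2)] by blast
  qed
  moreover have "1 \<le> k" "k \<le> n + 1" using k(1) by simp_all
  moreover have "v k < 0" using np[of k] k(1) by simp
  ultimately have "leading n v (- int k)"
    using np by (simp add: leading_neg_iff)
  then show ?thesis ..
qed

lemma step_above:
  "1 \<le> k \<Longrightarrow> k < i \<Longrightarrow> i \<le> n + 1 \<Longrightarrow> step n M (int k) v (i - 1) = v i"
  "n \<ge> 3 \<Longrightarrow> 2 \<le> k \<Longrightarrow> k < i \<Longrightarrow> i \<le> n + 1 \<Longrightarrow> step n M (- int k) v (i - 1) = v i"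
  "n \<ge> 3 \<Longrightarrow> 2 < i \<Longrightarrow> i \<le> n + 1 \<Longrightarrow> step n M (- 1) v (i - 1) = v i"
  by (auto simp: step_simps)

text \<open>Before its final block the point has a single nonzero coordinate, 1 or
  \<open>-1\<close>, at the index that the block picks.\<close>

lemma leading_of_step_vanishes:
  assumes "n \<ge> 3" "p \<in> positions (n + 1)" "vanishes n (step n 1 p v)"
  shows "leading n v p"
  using assms(2)
proof (cases rule: positions_cases)
  note z = assms(3)[unfolded vanishes_def, rule_format]
  {
    case (1 k)
    then have "v k = 1" using z[of "n + 1"] by (simp add: step_simps)
    moreover have "v i = 0" if "k < i" "i \<le> n + 1" for i
      using z[of "i - 1"] step_above(1)[of k i n 1 v] that 1 by simp
    ultimately show ?thesis using 1 by (simp add: leading_pos_iff)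
  next
    case 2
    then have "v 1 = -1" "v 2 = 0" using z[of "n + 1"] z[of 1] assms(1) by (simp_all add: step_simps)
    moreover have "v i = 0" if "2 < i" "i \<le> n + 1" for i
      using z[of "i - 1"] step_above(3)[of n i 1 v] that 2 assms(1) by simp
    ultimately have "v i \<le> 0" if "1 \<le> i" "i \<le> n + 1" for i
      using that by (cases "i = 1"; cases "i = 2") auto
    then show ?thesis using 2 \<open>v 1 = -1\<close> leading_neg_iff[of 1 n v] by simp
  next
    case (3 k)
    then have "v k = -1" "v 1 = 0" using z[of "n + 1"] z[of 1] assms(1) by (simp_all add: step_simps)
    moreover have "v i = 0" if "k < i" "i \<le> n + 1" for i
      using z[of "i - 1"] step_above(2)[of n k i 1 v] that 3 assms(1) by simp
    moreover have "v i = 0" if "2 \<le> i" "i < k" for i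
      using z[of i] that 3 assms(1) by (simp add: step_simps)
    ultimately have "v i = (if i = k then -1 else 0)" if "1 \<le> i" "i \<le> n + 1" for i
      using that 3 by (cases "i = 1"; cases i k rule: linorder_cases) auto
    then show ?thesis using 3 by (simp add: leading_neg_iff)
  }
qed

text \<open>Backward step for uniqueness. If the greedy rule picks \<open>p'\<close> after the
  block, \<open>follows p p'\<close> makes the freshly created last coordinate nonpositive, which
  fixes the sign of the coordinate it came from; the remaining sign conditions are carried back
  along the shift.\<close>

lemma leading_of_step:
  assumes "n \<ge> 3" "p \<in> positions (n + 1)" "follows p p'" "leading n (step n 1 p v) p'"
  shows "leading n v p"
proof -
  let ?v = "step n 1 p v"
  have p': "p' \<in> positions (n + 1)" using assms(4) by (simp add: leading_def)
  show ?thesis using assms(2)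
  proof (cases rule: positions_cases)
    case (1 k)
    have "p' < p" using assms(3) 1 by (auto simp: follows_def)
    have np: "?v i \<le> 0" if "k \<le> i" "i \<le> n + 1" for i
    proof (cases "p' > 0")
      case True
      then show ?thesis using assms(4) that \<open>p' < p\<close> 1 by (auto simp: leading_def)
    next
      case False
      then show ?thesis using assms(4) that 1 by (auto simp: leading_def)
    qed
    \<comment> \<open>Index \<open>n + 1\<close> now holds \<open>1 - v k\<close>, so nonpositivity
      there gives \<open>v k \<ge> 1\<close>.\<close>
    have "v k > 0" using np[of "n + 1"] 1 by (simp add: step_simps)
    moreover have "v i \<le> 0" if "k < i" "i \<le> n + 1" for i
      using np[of "i - 1"] step_above(1)[of k i n 1 v] that 1 by simp
    ultimately show ?thesis using 1 by (simp add: leading_pos_iff)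
  next
    case 2
    have p'': "p' = 1 \<or> p' \<le> -2" using assms(3) 2 by (auto simp: follows_def)
    have np: "?v i \<le> 0" if "2 \<le> i" "i \<le> n + 1" for i
      using p'' assms(4) that by (auto simp: leading_def)
    have "?v 1 \<ge> 0" using p''
    proof
      assume "p' = 1"
      then show ?thesis using assms(4) by (simp add: leading_def)
    next
      assume "p' \<le> -2"
      then have "?v 1 = 0" using assms(4) by (simp add: leading_def)
      then show ?thesis by simp
    qed
    then have "v 2 \<le> 0" using 2 assms(1) by (simp add: step_simps)
    have "v 1 < 0" using np[of "n + 1"] 2 assms(1) by (simp add: step_simps)
    moreover have "v i \<le> 0" if "2 < i" "i \<le> n + 1" for i
      using np[of "i - 1"] step_above(3)[of n i 1 v] that 2 assms(1) by simp
    ultimately have "v i \<le> 0" if "1 \<le> i" "i \<le> n + 1" for i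
      using that \<open>v 2 \<le> 0\<close> by (cases "i = 1"; cases "i = 2") auto
    then show ?thesis using 2 \<open>v 1 < 0\<close> leading_neg_iff[of 1 n v] by simp
  next
    case (3 k)
    have "p' \<le> p" using 3 assms(3) by (auto simp: follows_def split: if_splits)
    have np: "?v i \<le> 0" if "1 \<le> i" "i \<le> n + 1" for i
      using assms(4) that \<open>p' \<le> p\<close> 3 by (simp add: leading_def)
    have z: "?v i = 0" if "1 \<le> i" "i < k" for i
      using assms(4) that \<open>p' \<le> p\<close> 3 by (simp add: leading_def)
    have "v k < 0" using np[of "n + 1"] 3 assms(1) by (simp add: step_simps)
    moreover have "v 1 = 0" using z[of 1] 3 assms(1) by (simp add: step_simps)
    moreover have "v i \<le> 0" if "k < i" "i \<le> n + 1" for i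
      using np[of "i - 1"] step_above(2)[of n k i 1 v] that 3 assms(1) by simp
    moreover have "v i = 0" if "2 \<le> i" "i < k" for i
      using z[of i] that 3 assms(1) by (simp add: step_simps)
    ultimately have "v i \<le> 0 \<and> (i < k \<longrightarrow> v i = 0)" if "1 \<le> i" "i \<le> n + 1" for i
      using that 3 by (cases "i = 1"; cases i k rule: linorder_cases) auto
    then show ?thesis using 3 \<open>v k < 0\<close> by (simp add: leading_neg_iff)
  qed
qed

text \<open>Forward counterpart for existence: by integrality the created coordinate is nonpositive
  after a greedy block, and the others have only moved, so the next greedy choice cannot violate the
  constraint.\<close>

lemma leading_step_follows:
  assumes "n \<ge> 3" "leading n v p" "leading n (step n 1 p v) p'"
  shows "follows p p'"
proof -
  let ?v = "step n 1 p v"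
  have p: "p \<in> positions (n + 1)" and p': "p' \<in> positions (n + 1)"
    using assms(2,3) by (simp_all add: leading_def)
  show ?thesis using p
  proof (cases rule: positions_cases)
    case (1 k)
    have v: "v k > 0" "\<And>i. k < i \<Longrightarrow> i \<le> n + 1 \<Longrightarrow> v i \<le> 0"
      using assms(2) 1 by (simp_all add: leading_pos_iff)
    have "?v i \<le> 0" if "k \<le> i" "i \<le> n + 1" for i
      using v(1) v(2)[of "i + 1"] that 1 by (auto simp: step_simps)
    then have "\<not> p' \<ge> p" using assms(3) p' 1
      by (cases rule: positions_cases[OF p']) (force simp: leading_def positions_def)+
    then show ?thesis using 1 by (simp add: follows_def)
  next
    case 2
    have v: "v 1 < 0" "\<And>i. 1 \<le> i \<Longrightarrow> i \<le> n + 1 \<Longrightarrow> v i \<le> 0"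
      using assms(2) 2 leading_neg_iff[of 1 n v] by simp_all
    have np: "?v i \<le> 0" if "2 \<le> i" "i \<le> n + 1" for i
      using v(1) v(2)[of "i + 1"] that 2 assms(1) by (auto simp: step_simps)
    have "?v 1 \<ge> 0" using v(2)[of 2] 2 assms(1) by (simp add: step_simps)
    then have "p' \<noteq> -1" using assms(3) by (auto simp: leading_def)
    moreover have "\<not> p' \<ge> 2"
    proof
      assume "p' \<ge> 2"
      then have "?v (nat p') > 0" "2 \<le> nat p'" "nat p' \<le> n + 1"
        using assms(3) p' by (auto simp: leading_def positions_def)
      then show False using np[of "nat p'"] by simp
    qed
    ultimately show ?thesis using 2 p' by (auto simp: follows_def positions_def)
  next
    case (3 k)
    have v: "v k < 0" "\<And>i. 1 \<le> i \<Longrightarrow> i \<le> n + 1 \<Longrightarrow> v i \<le> 0" "\<And>i. 1 \<le> i \<Longrightarrow> i < k \<Longrightarrow> v i = 0"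
      using assms(2) 3 by (simp_all add: leading_neg_iff)
    have np: "?v i \<le> 0" if "1 \<le> i" "i \<le> n + 1" for i
      using v(1) v(2)[of "i + 1"] v(2)[of i] v(3)[of 1] that 3 assms(1) by (auto simp: step_simps)
    have z: "?v i = 0" if "1 \<le> i" "i < k" for i
      using v(3)[of i] that 3 assms(1) by (auto simp: step_simps)
    have "\<not> p' > 0"
    proof
      assume "p' > 0"
      then have "?v (nat p') > 0" "1 \<le> nat p'" "nat p' \<le> n + 1"
        using assms(3) p' by (auto simp: leading_def positions_def)
      then show False using np[of "nat p'"] by simp
    qed
    moreover have "\<not> (p < p' \<and> p' < 0)"
    proof
      assume "p < p' \<and> p' < 0"
      then have "?v (nat (- p')) < 0" "1 \<le> nat (- p')" "nat (- p') < k"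
        using assms(3) p' 3 by (auto simp: leading_def positions_def)
      then show False using z[of "nat (- p')"] by simp
    qed
    ultimately show ?thesis using 3 p' by (auto simp: follows_def positions_def)
  qed
qed

lemma fold_gact_blocks_Cons:
  assumes "p \<in> positions (n + 1)" "n \<ge> 3"
  shows "fold (gact n M) (blocks n (p # ps)) v = fold (gact n M) (blocks n ps) (step n M p v)"
proof -
  have "blocks n (p # ps) = (coset_word p n @ [n + 1]) @ blocks n ps" by (simp add: blocks_def)
  then show ?thesis using fold_gact_block[OF assms] by (simp del: append_assoc)
qed

text \<open>The sign conditions propagate from the last block, which reaches the origin, back to the
  start; so admissible blocks leave no freedom at any point.\<close>

lemma leading_hd:
  assumes "n \<ge> 3" "ps \<noteq> []" "set ps \<subseteq> positions (n + 1)" "successively follows ps"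
    and "vanishes n (fold (gact n 1) (blocks n ps) v)"
  shows "leading n v (hd ps)"
  using assms(2-)
proof (induction ps arbitrary: v)
  case (Cons p ps)
  have p: "p \<in> positions (n + 1)" using Cons.prems by simp
  note v = Cons.prems(4)[unfolded fold_gact_blocks_Cons[OF p assms(1)]]
  show ?case
  proof (cases "ps = []")
    case True
    then show ?thesis using leading_of_step_vanishes[OF assms(1) p] v by (simp add: blocks_def)
  next
    case False
    then have "leading n (step n 1 p v) (hd ps)"
      using Cons.IH[OF False] Cons.prems v by (auto simp: successively_Cons)
    then show ?thesis
      using leading_of_step[OF assms(1) p] False Cons.prems by (auto simp: successively_Cons)
  qed
qed simp

lemma blocks_unique:
  assumes "n \<ge> 3"
    and "set ps \<subseteq> positions (n + 1)" "successively follows ps"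
    and "vanishes n (fold (gact n 1) (blocks n ps) v)"
    and "set qs \<subseteq> positions (n + 1)" "successively follows qs"
    and "vanishes n (fold (gact n 1) (blocks n qs) v)"
  shows "ps = qs"
  using assms(2-)
proof (induction ps arbitrary: qs v)
  case Nil
  then have "vanishes n v" by (simp add: blocks_def)
  then show ?case
    using leading_hd[OF assms(1) _ Nil(4-6)] leading_not_vanishes by blast
next
  case (Cons p ps)
  have lead: "leading n v p"
    using leading_hd[OF assms(1) _ Cons.prems(1-3)] by simp
  then have "qs \<noteq> []"
    using Cons.prems(6) leading_not_vanishes by (auto simp: blocks_def)
  then have "leading n v (hd qs)" by (rule leading_hd[OF assms(1) _ Cons.prems(4-6)])
  then have "hd qs = p" using lead leading_unique by blast
  with \<open>qs \<noteq> []\<close> obtain qs' where qs: "qs = p # qs'" by (cases qs) auto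
  have p: "p \<in> positions (n + 1)" using Cons.prems by simp
  have "ps = qs'"
    using Cons.prems unfolding qs fold_gact_blocks_Cons[OF p assms(1)]
    by (intro Cons.IH) (auto simp: successively_Cons)
  then show ?case by (simp add: qs)
qed

lemma blocks_exist:
  assumes "n \<ge> 3"
  shows "\<exists>ps. set ps \<subseteq> positions (n + 1) \<and> successively follows ps \<and>
    vanishes n (fold (gact n 1) (blocks n ps) v)"
proof (induction "nat (taxicab n v)" arbitrary: v rule: less_induct)
  case less
  show ?case
  proof (cases "vanishes n v")
    case True
    then show ?thesis by (intro exI[of _ "[]"]) (simp add: blocks_def)
  next
    case False
    then obtain p where lead: "leading n v p" using leading_exists by blast
    then have p: "p \<in> positions (n + 1)" by (simp add: leading_def)
    have "taxicab n (step n 1 p v) = taxicab n v - 1"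
      by (rule taxicab_step[OF assms p leading_entry[OF lead]])
    moreover have "taxicab n (step n 1 p v) \<ge> 0" by (simp add: taxicab_def sum_nonneg)
    ultimately have "nat (taxicab n (step n 1 p v)) < nat (taxicab n v)" by simp
    from less[OF this] obtain ps where ps: "set ps \<subseteq> positions (n + 1)" "successively follows ps"
      "vanishes n (fold (gact n 1) (blocks n ps) (step n 1 p v))" by blast
    \<comment> \<open>The induction hypothesis does not reveal the head of \<open>ps\<close>. Since
      \<open>ps\<close> leads to the origin, its head must be the greedy choice.\<close>
    have "ps = [] \<or> follows p (hd ps)"
      using leading_hd[OF assms _ ps] leading_step_follows[OF assms lead] by blast
    then have "set (p # ps) \<subseteq> positions (n + 1) \<and> successively follows (p # ps) \<and>
        vanishes n (fold (gact n 1) (blocks n (p # ps)) v)"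
      using ps p fold_gact_blocks_Cons[OF p assms] by (auto simp: successively_Cons)
    then show ?thesis ..
  qed
qed

subsection \<open>The stabilizer of the origin\<close>

locale Btilde_rank =
  fixes n :: nat
  assumes n: "n \<ge> 3"
begin

abbreviation words :: "nat list set" where
  "words \<equiv> lists (Btilde_gens n)"

lemma words_iff: "u \<in> words \<longleftrightarrow> (\<forall>s\<in>set u. s \<le> n + 1)"
  by (auto simp: Btilde_gens_iff)

section \<open>Calculating with words modulo the relations\<close>

lemma eqv_refl: "u \<in> words \<Longrightarrow> eqv n u u"
  by (rule cox_eq.refl)

lemmas eqv_trans [trans] = cox_eq.trans[of "Btilde_gens n" "Btilde_matrix n"]
lemmas eqv_sym = cox_eq.sym[of "Btilde_gens n" "Btilde_matrix n"]

text \<open>Rewriting inside a word. The shapes of \<open>w\<close> and \<open>w'\<close> are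
  premises, so that a calculation step names only the surrounding words and leaves the regrouping of
  appends to the simplifier.\<close>

lemma eqv_subst:
  assumes "eqv n u u'" "w = x @ u @ y" "w' = x @ u' @ y" "x \<in> words" "y \<in> words"
  shows "eqv n w w'"
  unfolding assms(2,3) by (intro cox_eq_append_left cox_eq_append_right assms)

lemma eqv_square: "s \<le> n + 1 \<Longrightarrow> eqv n [s, s] []"
  using cox_eq.relator[of "[]" "Btilde_gens n" "[]" s s "Btilde_matrix n"]
  by (simp add: Btilde_gens_iff Btilde_matrix_def)

lemma eqv_rev_right: "u \<in> words \<Longrightarrow> eqv n (u @ rev u) []"
proof (induction u)
  case (Cons s u)
  then have s: "s \<le> n + 1" and u: "u \<in> words" by (auto simp: Btilde_gens_iff)
  have "eqv n (s # u @ rev u @ [s]) [s, s]"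
    by (rule eqv_subst[OF Cons.IH[OF u], of _ "[s]" "[s]"]) (use s in \<open>auto simp: Btilde_gens_iff\<close>)
  then show ?case using eqv_trans[OF _ eqv_square[OF s]] by simp
qed (simp add: eqv_refl)

lemma eqv_rev_left: "u \<in> words \<Longrightarrow> eqv n (rev u @ u) []"
  using eqv_rev_right[of "rev u"] by (simp add: words_iff)

lemma eqv_rev:
  assumes "eqv n u v"
  shows "eqv n (rev u) (rev v)"
proof -
  have w: "u \<in> words" "v \<in> words" using cox_eq_lists[OF assms] by auto
  then have r: "rev u \<in> words" "rev v \<in> words" by (auto simp: words_iff)
  have "eqv n (rev u) (rev u @ v @ rev v)"
    by (rule eqv_subst[OF eqv_sym[OF eqv_rev_right[OF w(2)]], of _ "rev u" "[]"]) (use r in auto)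
  also have "eqv n \<dots> (rev u @ u @ rev v)"
    by (rule eqv_subst[OF eqv_sym[OF assms], of _ "rev u" "rev v"]) (use r in auto)
  also have "eqv n \<dots> (rev v)"
    by (rule eqv_subst[OF eqv_rev_left[OF w(1)], of _ "[]" "rev v"]) (use r in auto)
  finally show ?thesis .
qed

text \<open>Splits a relator into the two sides of a commutation or braid relation: letters are
  involutions, so reversal inverts a word.\<close>

lemma eqv_of_trivial:
  assumes "eqv n (u @ v) []" "u \<in> words" "v \<in> words"
  shows "eqv n u (rev v)"
proof -
  have r: "rev v \<in> words" using assms(3) by (auto simp: words_iff)
  have "eqv n u (u @ v @ rev v)"
    by (rule eqv_subst[OF eqv_sym[OF eqv_rev_right[OF assms(3)]], of _ u "[]"]) (use assms in auto)
  also have "eqv n \<dots> (rev v)"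
    by (rule eqv_subst[OF assms(1), of _ "[]" "rev v"]) (use r in auto)
  finally show ?thesis .
qed

lemma eqv_relator:
  "s \<le> n + 1 \<Longrightarrow> t \<le> n + 1 \<Longrightarrow> eqv n (concat (replicate (Btilde_matrix n s t) [s, t])) []"
  using cox_eq.relator[of "[]" "Btilde_gens n" "[]" s t "Btilde_matrix n"]
  by (simp add: Btilde_gens_iff)

lemma eqv_comm:
  assumes "s \<le> n + 1" "t \<le> n + 1" "Btilde_matrix n s t = 2"
  shows "eqv n [s, t] [t, s]"
  using eqv_of_trivial[of "[s, t]" "[s, t]"] eqv_relator[OF assms(1,2)] assms
  by (simp add: numeral_eq_Suc words_iff)

lemma eqv_braid:
  assumes "s \<le> n + 1" "t \<le> n + 1" "Btilde_matrix n s t = 3"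
  shows "eqv n [s, t, s] [t, s, t]"
  using eqv_of_trivial[of "[s, t, s]" "[t, s, t]"] eqv_relator[OF assms(1,2)] assms
  by (simp add: numeral_eq_Suc words_iff)

lemma eqv_braid4: "eqv n [n, n + 1, n, n + 1] [n + 1, n, n + 1, n]"
proof -
  have "Btilde_matrix n n (n + 1) = 4" by (simp add: Btilde_matrix_def)
  then show ?thesis
    using eqv_of_trivial[of "[n, n + 1, n, n + 1]" "[n, n + 1, n, n + 1]"] eqv_relator[of n "n + 1"]
    by (simp add: numeral_eq_Suc words_iff)
qed

text \<open>Generators not joined in the Coxeter graph, oriented by \<open>a < b\<close>. Letter 0
  is joined to 2 only, hence its own clauses.\<close>

definition far :: "nat \<Rightarrow> nat \<Rightarrow> bool" where
  "far a b \<longleftrightarrow> a = 0 \<and> b = 1 \<or> a = 0 \<and> b \<ge> 3 \<or> 1 \<le> a \<and> a + 2 \<le> b"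

lemma eqv_far:
  assumes "far a b" "b \<le> n + 1"
  shows "eqv n [a, b] [b, a]"
proof -
  have "Btilde_matrix n a b = 2"
    using assms n by (auto simp: far_def Btilde_matrix_def doubleton_eq_iff)
  moreover have "a \<le> n + 1" using assms by (auto simp: far_def)
  ultimately show ?thesis using eqv_comm assms(2) by blast
qed

lemma eqv_far_word:
  assumes "\<forall>a\<in>set u. far a b" "b \<le> n + 1"
  shows "eqv n (u @ [b]) (b # u)"
  using assms(1)
proof (induction u)
  case (Cons a u)
  have w: "u \<in> words" "a \<le> n + 1"
    using Cons.prems assms(2) by (auto simp: words_iff far_def intro: order_trans)
  have "eqv n (a # u @ [b]) (a # b # u)"
    by (rule eqv_subst[OF Cons.IH, of _ "[a]" "[]"]) (use Cons.prems w in \<open>auto simp: words_iff\<close>)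
  also have "eqv n \<dots> (b # a # u)"
    by (rule eqv_subst[OF eqv_far[of a b], of _ "[]" u]) (use Cons.prems w assms(2) in auto)
  finally show ?case by simp
qed (use assms(2) in \<open>auto intro!: eqv_refl simp: Btilde_gens_iff\<close>)

lemma eqv_adjacent:
  assumes "1 \<le> s \<and> t = s + 1 \<or> s = 0 \<and> t = 2" "t \<le> n"
  shows "eqv n [s, t, s] [t, s, t]" "eqv n [t, s, t] [s, t, s]"
proof -
  have "Btilde_matrix n s t = 3"
    using assms n by (auto simp: Btilde_matrix_def doubleton_eq_iff)
  then show "eqv n [s, t, s] [t, s, t]" using eqv_braid[of s t] assms by auto
  then show "eqv n [t, s, t] [s, t, s]" by (rule eqv_sym)
qed

section \<open>Coset representatives in type D under left multiplication\<close>

text \<open>The action of the letters up to \<open>n\<close> on the signed unit vectors; letter 0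
  exchanges index 1 with \<open>-2\<close> and 2 with \<open>-1\<close>.\<close>

definition act_pos :: "nat \<Rightarrow> int \<Rightarrow> int" where
  "act_pos s p =
    (if s = 0 then if \<bar>p\<bar> = 1 then - 2 * sgn p else if \<bar>p\<bar> = 2 then - sgn p else p
     else if \<bar>p\<bar> = int s then sgn p * (int s + 1)
     else if \<bar>p\<bar> = int s + 1 then sgn p * int s else p)"

lemma coset_word_Suc:
  "p \<in> positions (m + 1) \<Longrightarrow> m \<ge> 1 \<Longrightarrow> coset_word p (Suc m) = coset_word p m @ [Suc m]"
  by (auto simp: coset_word_def positions_def)

lemma coset_word_top: "coset_word (int m + 1) m = []"
  by (simp add: coset_word_def nat_add_distrib)

lemma coset_word_bot: "m \<ge> 2 \<Longrightarrow> coset_word (- int m - 1) m = m # coset_word (- int m) m"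
proof -
  assume "m \<ge> 2"
  moreover have "nat (- (- int m - 1)) = Suc m" "nat (- (- int m)) = m" by auto
  ultimately show ?thesis by (simp add: coset_word_def)
qed

lemma coset_word_in_words:
  "p \<in> positions (m + 1) \<Longrightarrow> 1 \<le> m \<Longrightarrow> m \<le> n \<Longrightarrow> coset_word p m \<in> words"
  using coset_word_letters[of p m] by (auto simp: words_iff subset_iff)

text \<open>The letters available for the stabilizer of the last coordinate; for \<open>m = 1\<close> it is trivial.\<close>

definition stab_letters :: "nat \<Rightarrow> nat set" where
  "stab_letters m = (if m \<le> 1 then {} else {0..<m})"

lemma stab_letters_far: "a \<in> stab_letters m \<Longrightarrow> far a (Suc m)"
  by (auto simp: stab_letters_def far_def split: if_splits)

lemma stab_letters_mono: "stab_letters m \<subseteq> stab_letters (Suc m)"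
  by (auto simp: stab_letters_def)

lemma letter_coset_word_base:
  assumes "p \<in> positions 2" "s \<le> 1"
  shows "eqv n (s # coset_word p 1) (coset_word (act_pos s p) 1)"
proof -
  have s: "s = 0 \<or> s = 1" using assms(2) by auto
  have p: "p = 1 \<or> p = -1 \<or> p = 2 \<or> p = -2" using assms(1) by (auto simp: positions_def)
  have comm: "eqv n [0, 1] [1, 0]" by (rule eqv_far) (use n in \<open>auto simp: far_def\<close>)
  have w: "[0] \<in> words" "[1] \<in> words" "[1, 0] \<in> words" by (auto simp: Btilde_gens_iff)
  have "eqv n [1, 1, 0] [0]"
    by (rule eqv_subst[OF eqv_square[of 1], of _ "[]" "[0]"]) (auto simp: words_iff)
  moreover have "eqv n [0, 1, 0] [1]"
  proof -
    have "eqv n [0, 1, 0] [1, 0, 0]"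
      by (rule eqv_subst[OF comm, of _ "[]" "[0]"]) (auto simp: words_iff)
    also have "eqv n \<dots> [1]"
      by (rule eqv_subst[OF eqv_square[of 0], of _ "[1]" "[]"]) (use n in \<open>auto simp: words_iff\<close>)
    finally show ?thesis .
  qed
  moreover have "eqv n [0] [0]" "eqv n [1] [1]" "eqv n [1, 0] [1, 0]"
    using w by (auto intro: eqv_refl)
  ultimately show ?thesis using s p comm eqv_square[of 0] eqv_square[of 1]
    by (elim disjE) (simp_all add: coset_word_def act_pos_def)
qed

text \<open>A letter permutes the cosets of the stabilizer of the last coordinate, up to a factor
  \<open>y\<close> from that stabilizer. One rank higher, a coset word gains the final letter
  \<open>Suc m\<close>, which commutes with the old factor. What remains are the two new positions
  at the ends and the new letter \<open>Suc m\<close> itself.\<close>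

lemma letter_coset_word_step:
  assumes m: "1 \<le> m" "Suc m \<le> n" and p: "p \<in> positions (Suc m + 1)" and s: "s \<le> Suc m"
    and IH: "\<And>p s. p \<in> positions (m + 1) \<Longrightarrow> s \<le> m \<Longrightarrow>
      \<exists>y\<in>lists (stab_letters m). eqv n (s # coset_word p m) (coset_word (act_pos s p) m @ y)"
  shows "\<exists>y\<in>lists (stab_letters (Suc m)).
    eqv n (s # coset_word p (Suc m)) (coset_word (act_pos s p) (Suc m) @ y)"
proof -
  let ?M = "Suc m"
  have Mw: "[?M] \<in> words" "[m] \<in> words" "[?M, m] \<in> words" using m by (auto simp: words_iff)
  have sw: "[s] \<in> words" using m s by (auto simp: words_iff)
  have move: "eqv n (y @ [?M]) (?M # y)" if "y \<in> lists (stab_letters m)" for y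
    by (rule eqv_far_word) (use that m in \<open>auto simp: stab_letters_far\<close>)
  have last: "eqv n (s # coset_word p ?M) (coset_word (act_pos s p) ?M @ y)"
    if "p \<in> positions (m + 1)" "act_pos s p \<in> positions (m + 1)" "y \<in> lists (stab_letters m)"
      "eqv n (s # coset_word p m) (coset_word (act_pos s p) m @ y)" for p s y
  proof -
    have "eqv n (s # coset_word p m @ [?M]) (coset_word (act_pos s p) m @ y @ [?M])"
      by (rule eqv_subst[OF that(4), of _ "[]" "[?M]"]) (use Mw in auto)
    also have "eqv n \<dots> (coset_word (act_pos s p) m @ ?M # y)"
      by (rule eqv_subst[OF move[OF that(3)], of _ "coset_word (act_pos s p) m" "[]"])
        (use coset_word_in_words[OF that(2)] m in auto)
    finally show ?thesis using coset_word_Suc that(1,2) m by simp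
  qed
  consider (small) "p \<in> positions (m + 1)" "s \<le> m"
    | (top1) "p = int ?M" "s = ?M" | (bot1) "p = - int ?M" "s = ?M"
    | (mid) "p \<in> positions m" "s = ?M"
    | (top) "p = int ?M + 1" | (bot) "p = - int ?M - 1"
    using p s by (fastforce simp: positions_def)
  then show ?thesis
  proof cases
    case small
    then have "act_pos s p \<in> positions (m + 1)"
      using m by (auto simp: act_pos_def positions_def sgn_if)
    with IH[OF small] last small stab_letters_mono show ?thesis
      by (meson in_lists_conv_set subsetD)
  next
    case top1
    have "coset_word p ?M = [?M]" using top1 by (simp add: coset_word_def nat_add_distrib)
    moreover have "coset_word (act_pos s p) ?M = []"
      using top1 coset_word_top[of ?M] by (simp add: act_pos_def)
    ultimately show ?thesis using eqv_square[of ?M] top1 m by (intro bexI[of _ "[]"]) auto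
  next
    case bot1
    have "act_pos s p = - int ?M - 1" using bot1 by (simp add: act_pos_def)
    then have "coset_word (act_pos s p) ?M = s # coset_word p ?M"
      using bot1 m coset_word_bot[of ?M] by simp
    moreover have "coset_word p ?M \<in> words"
      by (rule coset_word_in_words) (use bot1 m in \<open>auto simp: positions_def\<close>)
    ultimately show ?thesis using sw
      by (intro bexI[of _ "[]"]) (auto intro!: eqv_refl)
  next
    case mid
    have fix_p: "act_pos s p = p" using mid by (auto simp: act_pos_def positions_def)
    have pos: "p \<in> positions (m + 1)" using mid by (auto simp: positions_def)
    show ?thesis
    proof (cases "m = 1")
      case True
      \<comment> \<open>At the branch node the coset words of 1 and \<open>-1\<close> begin with the
        letters 1 and 0; each of these satisfies a braid relation with 2.\<close>
      then have p1: "p = 1 \<or> p = -1" using mid by (auto simp: positions_def)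
      have "eqv n [2, 1, 2] [1, 2, 1]" "eqv n [2, 0, 2] [0, 2, 0]"
        by (rule eqv_adjacent(2); use n in simp)+
      moreover have "coset_word 1 2 = [1, 2]" "coset_word (-1) 2 = [0, 2]"
        by (simp_all add: coset_word_def upt_rec numeral_2_eq_2)
      ultimately have "eqv n (s # coset_word p ?M) (coset_word p ?M @ [if p = 1 then 1 else 0])"
        using p1 True mid(2) by (auto simp: numeral_2_eq_2)
      then show ?thesis unfolding fix_p using True
        by (intro bexI[of _ "[if p = 1 then 1 else 0]"]) (auto simp: stab_letters_def)
    next
      case False
      then obtain l where l: "m = Suc l" "1 \<le> l" using m by (cases m) auto
      let ?c = "coset_word p l"
      have c: "coset_word p ?M = ?c @ [m, ?M]"
        using coset_word_Suc[of p l] coset_word_Suc[OF pos m(1)] mid l by simp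
      have letters: "set ?c \<subseteq> {0..l}" using coset_word_letters[of p l] mid l by simp
      then have cw: "?c \<in> words" using l m by (auto simp: words_iff subset_iff)
      have far: "eqv n (?c @ [?M]) (?M # ?c)"
        by (rule eqv_far_word) (use letters l m in \<open>auto simp: far_def subset_iff\<close>)
      \<comment> \<open>The new letter commutes with \<open>?c\<close> until it meets
        \<open>m, Suc m\<close>; the braid relation then releases a trailing
        \<open>m\<close>.\<close>
      have "eqv n (?M # ?c @ [m, ?M]) (?c @ [?M, m, ?M])"
        by (rule eqv_subst[OF eqv_sym[OF far], of _ "[]" "[m, ?M]"]) (use Mw in auto)
      also have "eqv n \<dots> (?c @ [m, ?M, m])"
        by (rule eqv_subst[OF eqv_adjacent(2)[of m ?M], of _ ?c "[]"]) (use m cw in auto)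
      finally have "eqv n (s # coset_word p ?M) (coset_word p ?M @ [m])"
        using c mid(2) by simp
      then show ?thesis unfolding fix_p using l
        by (intro bexI[of _ "[m]"]) (auto simp: stab_letters_def)
    qed
  next
    case top
    show ?thesis
    proof (cases "s = ?M")
      case True
      have "coset_word (act_pos s p) ?M = [?M]"
        using top True by (simp add: act_pos_def coset_word_def nat_add_distrib)
      then show ?thesis using top True Mw coset_word_top[of ?M]
        by (intro bexI[of _ "[]"]) (auto intro!: eqv_refl)
    next
      case False
      then have "act_pos s p = p" using top s m by (auto simp: act_pos_def)
      then show ?thesis using top False s m sw coset_word_top[of ?M]
        by (intro bexI[of _ "[s]"]) (auto intro!: eqv_refl simp: stab_letters_def)
    qed
  next
    case bot
    let ?c = "coset_word (- int ?M) m"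
    have posM: "- int ?M \<in> positions (m + 1)" using m by (auto simp: positions_def)
    have cw: "?c \<in> words" by (rule coset_word_in_words[OF posM]) (use m in auto)
    have c: "coset_word p ?M = ?M # ?c @ [?M]"
      using coset_word_bot[of ?M] coset_word_Suc[OF posM] bot m by simp
    consider "s = ?M" | "s < m" "m \<ge> 2" | "s = m" "m \<ge> 2" | "m = 1" "s \<le> 1"
      using s m by linarith
    then show ?thesis
    proof cases
      case 1
      then have "act_pos s p = - int ?M" using bot by (simp add: act_pos_def)
      moreover have "eqv n (?M # ?M # ?c @ [?M]) (?c @ [?M])"
        by (rule eqv_subst[OF eqv_square[of ?M], of _ "[]" "?c @ [?M]"]) (use m cw Mw in auto)
      ultimately show ?thesis using c 1 coset_word_Suc[OF posM m(1)]
        by (intro bexI[of _ "[]"]) auto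
    next
      case 2
      have fix_p: "act_pos s p = p" "act_pos s (- int ?M) = - int ?M"
        using bot 2 by (auto simp: act_pos_def)
      obtain y where y: "y \<in> lists (stab_letters m)" "eqv n (s # ?c) (?c @ y)"
        using IH[OF posM, of s] 2 fix_p by auto
      have "eqv n (s # ?M # ?c @ [?M]) (?M # s # ?c @ [?M])"
        by (rule eqv_subst[OF eqv_far[of s ?M], of _ "[]" "?c @ [?M]"])
          (use m cw Mw 2 in \<open>auto simp: far_def\<close>)
      also have "eqv n \<dots> (?M # ?c @ y @ [?M])"
        by (rule eqv_subst[OF y(2), of _ "[?M]" "[?M]"]) (use Mw in auto)
      also have "eqv n \<dots> (?M # ?c @ [?M] @ y)"
        by (rule eqv_subst[OF move[OF y(1)], of _ "?M # ?c" "[]"]) (use Mw cw in auto)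
      finally have "eqv n (s # coset_word p ?M) (coset_word (act_pos s p) ?M @ y)"
        using c fix_p by simp
      moreover have "y \<in> lists (stab_letters ?M)" using y(1) stab_letters_mono[of m] by auto
      ultimately show ?thesis by blast
    next
      case 3
      then obtain l where l: "m = Suc l" "1 \<le> l" by (cases m) auto
      let ?b = "coset_word (- int m) l"
      have fix_p: "act_pos s p = p" using bot 3 by (auto simp: act_pos_def)
      have posm: "- int m \<in> positions (l + 1)" using l by (auto simp: positions_def)
      have cb: "?c = m # ?b @ [m]"
        using coset_word_bot[of m] coset_word_Suc[OF posm l(2)] l 3 by simp
      have letters: "set ?b \<subseteq> {0..l}" by (rule coset_word_letters[OF posm l(2)])
      then have bw: "?b \<in> words" using l m by (auto simp: words_iff subset_iff)
      have far: "eqv n (?b @ [?M]) (?M # ?b)"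
        by (rule eqv_far_word) (use letters l m in \<open>auto simp: far_def subset_iff\<close>)
      \<comment> \<open>The letter \<open>m\<close> is braided with the descending run, passes the
        middle as \<open>Suc m\<close>, and is braided with the ascending run, from which it emerges
        as \<open>m\<close>.\<close>
      have "eqv n (m # ?M # m # ?b @ [m, ?M]) (?M # m # ?M # ?b @ [m, ?M])"
        by (rule eqv_subst[OF eqv_adjacent(1)[of m ?M], of _ "[]" "?b @ [m, ?M]"])
          (use Mw bw m in auto)
      also have "eqv n \<dots> (?M # m # ?b @ [?M, m, ?M])"
        by (rule eqv_subst[OF eqv_sym[OF far], of _ "[?M, m]" "[m, ?M]"]) (use Mw in auto)
      also have "eqv n \<dots> (?M # m # ?b @ [m, ?M, m])"
        by (rule eqv_subst[OF eqv_adjacent(2)[of m ?M], of _ "?M # m # ?b" "[]"])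
          (use Mw bw m in auto)
      finally have "eqv n (s # coset_word p ?M) (coset_word (act_pos s p) ?M @ [m])"
        using c cb fix_p 3 by simp
      then show ?thesis using l by (intro bexI[of _ "[m]"]) (auto simp: stab_letters_def)
    next
      case 4
      \<comment> \<open>The coset word of \<open>-3\<close> also negates the first coordinate, and
        this exchanges the letters 0 and 1: the factor is the letter other than
        \<open>s\<close>.\<close>
      have p3: "p = -3" "?M = 2" using bot 4 by simp_all
      have c3: "coset_word (-3) 2 = [2, 1, 0, 2]"
        by (simp add: coset_word_def upt_rec numeral_2_eq_2 numeral_3_eq_3)
      have w: "[2, 1] \<in> words" "[2, 0] \<in> words" "[2] \<in> words" "[0, 2] \<in> words" "[0, 2, 0] \<in> words"
        "[1] \<in> words" "[0] \<in> words" "[2, 1, 0] \<in> words" "[1, 2] \<in> words"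
        using n by (auto simp: words_iff)
      have comm: "eqv n [0, 1] [1, 0]" by (rule eqv_far) (use n in \<open>auto simp: far_def\<close>)
      have br: "eqv n [1, 2, 1] [2, 1, 2]" "eqv n [2, 0, 2] [0, 2, 0]"
        "eqv n [0, 2, 0] [2, 0, 2]" "eqv n [2, 1, 2] [1, 2, 1]"
        by (rule eqv_adjacent; use n in simp)+
      show ?thesis
      proof (cases "s = 0")
        case True
        have "eqv n [0, 2, 1, 0, 2] [0, 2, 0, 1, 2]"
          by (rule eqv_subst[OF eqv_sym[OF comm], of _ "[0, 2]" "[2]"]) (use w in auto)
        also have "eqv n \<dots> [2, 0, 2, 1, 2]"
          by (rule eqv_subst[OF br(3), of _ "[]" "[1, 2]"]) (use w in auto)
        also have "eqv n \<dots> [2, 0, 1, 2, 1]"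
          by (rule eqv_subst[OF br(4), of _ "[2, 0]" "[]"]) (use w in auto)
        also have "eqv n \<dots> [2, 1, 0, 2, 1]"
          by (rule eqv_subst[OF comm, of _ "[2]" "[2, 1]"]) (use w in auto)
        finally show ?thesis unfolding p3 using True
          by (intro bexI[of _ "[1]"]) (auto simp: act_pos_def c3 stab_letters_def)
      next
        case False
        then have s1: "s = 1" using 4 by simp
        have "eqv n [1, 2, 1, 0, 2] [2, 1, 2, 0, 2]"
          by (rule eqv_subst[OF br(1), of _ "[]" "[0, 2]"]) (use w in auto)
        also have "eqv n \<dots> [2, 1, 0, 2, 0]"
          by (rule eqv_subst[OF br(2), of _ "[2, 1]" "[]"]) (use w in auto)
        finally show ?thesis unfolding p3 using s1
          by (intro bexI[of _ "[0]"]) (auto simp: act_pos_def c3 stab_letters_def)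
      qed
    qed
  qed
qed

lemma letter_coset_word:
  assumes "1 \<le> m" "m \<le> n" "p \<in> positions (m + 1)" "s \<le> m"
  shows "\<exists>y\<in>lists (stab_letters m). eqv n (s # coset_word p m) (coset_word (act_pos s p) m @ y)"
  using assms
proof (induction m arbitrary: p s rule: dec_induct)
  case base
  then show ?case using letter_coset_word_base[of p s]
    by (intro bexI[of _ "[]"]) (auto simp: numeral_2_eq_2)
next
  case (step m)
  show ?case
    by (rule letter_coset_word_step) (use step in auto)
qed

section \<open>Conjugates of the last generator and their commutation\<close>

lemma act_pos_positions: "p \<in> positions (m + 1) \<Longrightarrow> s \<le> m \<Longrightarrow> m \<ge> 1 \<Longrightarrow> act_pos s p \<in> positions (m + 1)"
  by (auto simp: act_pos_def positions_def sgn_if)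

lemma act_pos_invol: "p \<noteq> 0 \<Longrightarrow> act_pos s (act_pos s p) = p"
  by (auto simp: act_pos_def sgn_if)

lemma act_pos_minus: "act_pos s (- p) = - act_pos s p"
  by (auto simp: act_pos_def sgn_if)

text \<open>As affine maps, these are the reflections \<open>v k \<mapsto> \<plusminus>1 - v k\<close>.\<close>

definition refl_word :: "int \<Rightarrow> nat list" where
  "refl_word p = coset_word p n @ [n + 1] @ rev (coset_word p n)"

lemma coset_word_words: "p \<in> positions (n + 1) \<Longrightarrow> coset_word p n \<in> words"
  using coset_word_in_words[of p n] n by simp

lemma last_word: "[n + 1] \<in> words"
  by (auto simp: Btilde_gens_iff)

lemma refl_word_words: "p \<in> positions (n + 1) \<Longrightarrow> refl_word p \<in> words"
  using coset_word_words[of p] last_word by (simp add: refl_word_def words_iff)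

lemma refl_word_square:
  assumes "p \<in> positions (n + 1)"
  shows "eqv n (refl_word p @ refl_word p) []"
proof -
  have "rev (refl_word p) = refl_word p" by (simp add: refl_word_def)
  then show ?thesis using eqv_rev_right[OF refl_word_words[OF assms]] by simp
qed

text \<open>The stabilizer factor \<open>y\<close> commutes with the letter \<open>n + 1\<close> and
  cancels against its inverse from the reversed half.\<close>

lemma refl_word_conj:
  assumes "p \<in> positions (n + 1)" "s \<le> n"
  shows "eqv n (s # refl_word p) (refl_word (act_pos s p) @ [s])"
proof -
  let ?c = "coset_word p n" and ?d = "coset_word (act_pos s p) n"
  obtain y where y: "y \<in> lists (stab_letters n)" "eqv n (s # ?c) (?d @ y)"
    using letter_coset_word[of n p s] assms n by auto
  have sw: "[s] \<in> words" using assms(2) by (auto simp: Btilde_gens_iff)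
  have yw: "y \<in> words" using y(1) by (auto simp: words_iff stab_letters_def split: if_splits)
  have d: "?d \<in> words" by (rule coset_word_words[OF act_pos_positions]) (use assms n in auto)
  have r: "rev ?c \<in> words" "rev ?d \<in> words" "rev y \<in> words"
    using coset_word_words[OF assms(1)] d yw by (auto simp: words_iff)
  have move: "eqv n (y @ [n + 1]) ((n + 1) # y)"
    by (rule eqv_far_word) (use y(1) stab_letters_far[of _ n] in auto)
  have y': "eqv n (rev ?c @ [s]) (rev y @ rev ?d)" using eqv_rev[OF y(2)] by simp
  \<comment> \<open>Of the two appended letters one is absorbed by the reversed coset word, the
    other remains at the end.\<close>
  have "eqv n (s # refl_word p) (s # refl_word p @ [s, s])"
    by (rule eqv_subst[OF eqv_sym[OF eqv_square[of s]], of _ "s # refl_word p" "[]"])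
      (use assms(2) sw refl_word_words[OF assms(1)] in auto)
  also have "s # refl_word p @ [s, s] = (s # ?c) @ [n + 1] @ rev ?c @ [s, s]"
    by (simp add: refl_word_def)
  also have "eqv n \<dots> ((?d @ y) @ [n + 1] @ rev ?c @ [s, s])"
    by (rule eqv_subst[OF y(2), of _ "[]" "[n + 1] @ rev ?c @ [s, s]"]) (use r sw last_word in auto)
  also have "eqv n \<dots> ((?d @ y) @ [n + 1] @ (rev y @ rev ?d) @ [s])"
    by (rule eqv_subst[OF y', of _ "(?d @ y) @ [n + 1]" "[s]"]) (use d yw sw last_word in auto)
  also have "eqv n \<dots> (?d @ [n + 1] @ y @ rev y @ rev ?d @ [s])"
    by (rule eqv_subst[OF move, of _ ?d "rev y @ rev ?d @ [s]"]) (use d r sw in auto)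
  also have "eqv n \<dots> (?d @ [n + 1] @ rev ?d @ [s])"
    by (rule eqv_subst[OF eqv_rev_right[OF yw], of _ "?d @ [n + 1]" "rev ?d @ [s]"])
      (use d r sw last_word in auto)
  finally show ?thesis by (simp add: refl_word_def)
qed

definition commute :: "int \<Rightarrow> int \<Rightarrow> bool" where
  "commute p q \<longleftrightarrow> eqv n (refl_word p @ refl_word q) (refl_word q @ refl_word p)"

lemma commute_act_pos:
  assumes "p \<in> positions (n + 1)" "q \<in> positions (n + 1)" "s \<le> n" "commute p q"
  shows "commute (act_pos s p) (act_pos s q)"
proof -
  have sw: "[s] \<in> words" using assms(3) by (auto simp: Btilde_gens_iff)
  have conj: "eqv n (s # refl_word p @ refl_word q)
      (refl_word (act_pos s p) @ refl_word (act_pos s q) @ [s])"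
    if "p \<in> positions (n + 1)" "q \<in> positions (n + 1)" for p q
  proof -
    have p': "act_pos s p \<in> positions (n + 1)"
      by (rule act_pos_positions) (use that assms(3) n in auto)
    have "eqv n (s # refl_word p @ refl_word q) (refl_word (act_pos s p) @ [s] @ refl_word q)"
      by (rule eqv_subst[OF refl_word_conj[OF that(1) assms(3)], of _ "[]" "refl_word q"])
        (use refl_word_words[OF that(2)] in auto)
    also have "eqv n \<dots> (refl_word (act_pos s p) @ refl_word (act_pos s q) @ [s])"
      by (rule eqv_subst[OF refl_word_conj[OF that(2) assms(3)], of _ "refl_word (act_pos s p)" "[]"])
        (use refl_word_words[OF p'] in auto)
    finally show ?thesis .
  qed
  have p': "act_pos s p \<in> positions (n + 1)" "act_pos s q \<in> positions (n + 1)"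
    using act_pos_positions[of _ n s] assms n by auto
  let ?p = "refl_word (act_pos s p)" and ?q = "refl_word (act_pos s q)"
  have w: "?p \<in> words" "?q \<in> words" using refl_word_words p' by auto
  have "eqv n (?p @ ?q) (?p @ ?q @ [s, s])"
    by (rule eqv_subst[OF eqv_sym[OF eqv_square[of s]], of _ "?p @ ?q" "[]"])
      (use w assms(3) in auto)
  also have "eqv n \<dots> (s # refl_word p @ refl_word q @ [s])"
    by (rule eqv_subst[OF eqv_sym[OF conj[OF assms(1,2)]], of _ "[]" "[s]"]) (use sw in auto)
  also have "eqv n \<dots> (s # refl_word q @ refl_word p @ [s])"
    by (rule eqv_subst[OF assms(4)[unfolded commute_def], of _ "[s]" "[s]"]) (use sw in auto)
  also have "eqv n \<dots> (?q @ ?p @ [s, s])"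
    by (rule eqv_subst[OF conj[OF assms(2,1)], of _ "[]" "[s]"]) (use sw in auto)
  also have "eqv n \<dots> (?q @ ?p)"
    by (rule eqv_subst[OF eqv_square[of s], of _ "?q @ ?p" "[]"]) (use w assms(3) in auto)
  finally show ?thesis by (simp add: commute_def)
qed

text \<open>The letters act transitively on positions: down the positive indices, from 2 to
  \<open>-1\<close> by letter 0, and on through the negative ones.\<close>

lemma positions_induct [consumes 2, case_names top step]:
  assumes "p \<in> positions (m + 1)" "m \<ge> 1" and top: "P (int m + 1)"
    and step: "\<And>p s. p \<in> positions (m + 1) \<Longrightarrow> s \<le> m \<Longrightarrow> P p \<Longrightarrow> P (act_pos s p)"
  shows "P p"
proof -
  have pos: "P (int k)" if "1 \<le> k" "k \<le> m + 1" for k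
    using that(2,1)
  proof (induction k rule: inc_induct)
    case base
    then show ?case using top by (simp add: add.commute)
  next
    case (step k)
    then have "P (act_pos k (int (Suc k)))"
      by (intro assms(4)) (auto simp: positions_def)
    moreover have "act_pos k (int (Suc k)) = int k" using step by (simp add: act_pos_def)
    ultimately show ?case by simp
  qed
  have neg: "P (- int k)" if "1 \<le> k" "k \<le> m + 1" for k
    using that
  proof (induction k rule: dec_induct)
    case base
    have "P (act_pos 0 2)" by (rule step) (use pos[of 2] assms(2) in \<open>auto simp: positions_def\<close>)
    then show ?case by (simp add: act_pos_def)
  next
    case (step k)
    then have "P (act_pos k (- int k))"
      by (intro assms(4)) (auto simp: positions_def)
    moreover have "act_pos k (- int k) = - int (Suc k)" using step by (simp add: act_pos_def)
    ultimately show ?case by simp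
  qed
  show ?thesis using positions_signed[OF assms(1)] pos neg by metis
qed

text \<open>For index \<open>n\<close> this is the relation of label 4. Letters up to
  \<open>n - 1\<close> fix the index \<open>n + 1\<close> and carry \<open>n\<close> to every other
  position concerned, so conjugation does the rest.\<close>

lemma commute_top: "p \<in> positions n \<Longrightarrow> commute (int n + 1) p"
proof -
  assume "p \<in> positions n"
  then have "p \<in> positions (n - 1 + 1)" "n - 1 \<ge> 1" using n by simp_all
  then show ?thesis
  proof (induction p rule: positions_induct)
    case top
    have c: "coset_word (int n) n = [n]" "coset_word (int n + 1) n = []" "int (n - 1) + 1 = int n"
      using n coset_word_top[of n] by (simp_all add: coset_word_def)
    show ?case unfolding commute_def refl_word_def c
      using eqv_sym[OF eqv_braid4] by simp
  next
    case (step p s)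
    have "commute (act_pos s (int n + 1)) (act_pos s p)"
      by (rule commute_act_pos) (use step n in \<open>auto simp: positions_def\<close>)
    moreover have "act_pos s (int n + 1) = int n + 1"
      using step(2) n by (auto simp: act_pos_def)
    ultimately show ?case by simp
  qed
qed

text \<open>Conjugation reduces to \<open>p = n + 1\<close>. As \<open>act_pos s\<close> is an
  involution compatible with signs, \<open>q\<close> can be moved along and its index stays
  different.\<close>

lemma commute_positions:
  assumes "p \<in> positions (n + 1)" "q \<in> positions (n + 1)" "\<bar>p\<bar> \<noteq> \<bar>q\<bar>"
  shows "commute p q"
proof -
  have "n \<ge> 1" using n by simp
  with assms(1) have "\<forall>q\<in>positions (n + 1). \<bar>p\<bar> \<noteq> \<bar>q\<bar> \<longrightarrow> commute p q"
  proof (induction p rule: positions_induct)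
    case top
    show ?case by (auto intro!: commute_top simp: positions_def)
  next
    case (step p s)
    show ?case
    proof (intro ballI impI)
      fix q assume q: "q \<in> positions (n + 1)" "\<bar>act_pos s p\<bar> \<noteq> \<bar>q\<bar>"
      let ?q = "act_pos s q"
      have q0: "q \<noteq> 0" using q(1) by (auto simp: positions_def)
      have q': "?q \<in> positions (n + 1)"
        by (rule act_pos_positions) (use q(1) step(2) n in auto)
      have "\<bar>p\<bar> \<noteq> \<bar>?q\<bar>"
      proof
        assume "\<bar>p\<bar> = \<bar>?q\<bar>"
        then have "p = ?q \<or> p = - ?q" by linarith
        then have "act_pos s p = q \<or> act_pos s p = - q"
          using act_pos_invol[OF q0] act_pos_minus[of s ?q] by auto
        then show False using q(2) by auto
      qed
      then have "commute (act_pos s p) (act_pos s ?q)"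
        using step q' by (intro commute_act_pos) auto
      then show "commute (act_pos s p) q" using act_pos_invol[OF q0] by simp
    qed
  qed
  then show ?thesis using assms(2,3) by blast
qed

section \<open>Normal forms for products of reflections\<close>

definition refl_words :: "int list \<Rightarrow> nat list" where
  "refl_words ps = concat (map refl_word ps)"

definition flip :: "int \<Rightarrow> (nat \<Rightarrow> int) \<Rightarrow> nat \<Rightarrow> int" where
  "flip p v = v(nat \<bar>p\<bar> := sgn p - v (nat \<bar>p\<bar>))"

fun alternating :: "int \<Rightarrow> nat \<Rightarrow> int list" where
  "alternating p 0 = []"
| "alternating p (Suc m) = p # alternating (- p) m"

text \<open>The reduced word, in the infinite dihedral group of coordinate \<open>k\<close>, of the
  unique element sending 0 to \<open>z\<close>. Its length is \<open>\<bar>z\<bar>\<close>.\<close>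

definition coord_refls :: "nat \<Rightarrow> int \<Rightarrow> int list" where
  "coord_refls k z = (if z \<ge> 0 then alternating (int k) (nat z) else alternating (- int k) (nat (- z)))"

text \<open>The translation parts: the reflections with a fixed \<open>\<bar>p\<bar>\<close> generate an infinite dihedral
  group, and these commute with one another.\<close>

definition vector_word :: "(nat \<Rightarrow> int) \<Rightarrow> nat list \<Rightarrow> nat list" where
  "vector_word v ks = concat (map (\<lambda>k. refl_words (coord_refls k (v k))) ks)"

lemma set_alternating: "set (alternating p m) \<subseteq> {p, - p}"
proof (induction m arbitrary: p)
  case (Suc m)
  then show ?case using Suc.IH[of "- p"] by auto
qed simp

lemma set_coord_refls: "set (coord_refls k z) \<subseteq> {int k, - int k}"
  using set_alternating[of "int k" "nat z"] set_alternating[of "- int k" "nat (- z)"]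
  by (auto simp: coord_refls_def)

lemma refl_words_words: "set ps \<subseteq> positions (n + 1) \<Longrightarrow> refl_words ps \<in> words"
  using refl_word_words by (induction ps) (auto simp: refl_words_def)

lemma coord_refls_positions:
  "1 \<le> k \<Longrightarrow> k \<le> n + 1 \<Longrightarrow> set (coord_refls k z) \<subseteq> positions (n + 1)"
  using set_coord_refls[of k z] by (auto simp: positions_def)

lemma vector_word_words:
  "set ks \<subseteq> {1..n + 1} \<Longrightarrow> vector_word v ks \<in> words"
  using refl_words_words[OF coord_refls_positions] by (induction ks) (auto simp: vector_word_def)

text \<open>The case where \<open>p\<close> lengthens the alternating word:
  \<open>p * z \<le> 0\<close> means that the word for \<open>z\<close> is empty or starts with
  \<open>- p\<close>.\<close>

lemma coord_refls_Cons:
  assumes "\<bar>p\<bar> = int k" "k \<ge> 1" "p * z \<le> 0"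
  shows "coord_refls k (sgn p - z) = p # coord_refls k z"
proof (cases "p > 0")
  case True
  then have "p = int k" "z \<le> 0" using assms(1,3) by (simp_all add: mult_le_0_iff)
  moreover have "nat (1 - z) = Suc (nat (- z))" using \<open>z \<le> 0\<close> by simp
  ultimately show ?thesis using assms(2) by (cases "z = 0") (auto simp: coord_refls_def)
next
  case False
  then have "p < 0" "p = - int k" using assms(1,2) by linarith+
  have "z \<ge> 0" using assms(3) \<open>p < 0\<close> by (simp add: mult_le_0_iff)
  moreover note \<open>p = - int k\<close>
  moreover have "nat (1 + z) = Suc (nat z)" using \<open>z \<ge> 0\<close> by simp
  ultimately show ?thesis using assms(2) by (auto simp: coord_refls_def add.commute)
qed

text \<open>If \<open>p\<close> does not lengthen the word for \<open>z\<close>, it lengthens the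
  one for \<open>sgn p - z\<close>; then it is the first letter of the word for \<open>z\<close> and
  cancels.\<close>

lemma refl_word_coord_refls:
  assumes "p \<in> positions (n + 1)" "nat \<bar>p\<bar> = k"
  shows "eqv n (refl_word p @ refl_words (coord_refls k z)) (refl_words (coord_refls k (sgn p - z)))"
proof -
  have k: "\<bar>p\<bar> = int k" "k \<ge> 1" "k \<le> n + 1" using assms by (auto simp: positions_def)
  note w = refl_words_words[OF coord_refls_positions[OF k(2,3)]]
  show ?thesis
  proof (cases "p * z \<le> 0")
    case True
    then show ?thesis
      using coord_refls_Cons[OF k(1,2) True] w[of "sgn p - z"] by (simp add: refl_words_def eqv_refl)
  next
    case False
    have "p * (sgn p - z) \<le> 0"
    proof (cases "p > 0")
      case True
      then have "z > 0" using \<open>\<not> p * z \<le> 0\<close> by (simp add: mult_le_0_iff)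
      then show ?thesis using True by (simp add: mult_nonneg_nonpos)
    next
      case neg: False
      then have "p < 0" using k by linarith
      then have "z < 0" using \<open>\<not> p * z \<le> 0\<close> by (simp add: mult_le_0_iff)
      then show ?thesis using \<open>p < 0\<close> by (simp add: mult_nonpos_nonneg)
    qed
    then have "coord_refls k z = p # coord_refls k (sgn p - z)"
      using coord_refls_Cons[OF k(1,2), of "sgn p - z"] by simp
    then have "refl_words (coord_refls k z) = refl_word p @ refl_words (coord_refls k (sgn p - z))"
      by (simp add: refl_words_def)
    moreover have "eqv n ((refl_word p @ refl_word p) @ refl_words (coord_refls k (sgn p - z)))
        (refl_words (coord_refls k (sgn p - z)))"
      by (rule eqv_subst[OF refl_word_square[OF assms(1)], of _ "[]"
            "refl_words (coord_refls k (sgn p - z))"]) (use w in auto)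
    ultimately show ?thesis by simp
  qed
qed

lemma refl_word_move:
  assumes "p \<in> positions (n + 1)" "set ps \<subseteq> positions (n + 1)" "\<forall>q\<in>set ps. commute p q"
  shows "eqv n (refl_word p @ refl_words ps) (refl_words ps @ refl_word p)"
  using assms(2,3)
proof (induction ps)
  case Nil
  then show ?case using refl_word_words[OF assms(1)] by (simp add: refl_words_def eqv_refl)
next
  case (Cons q ps)
  have w: "refl_words ps \<in> words" "refl_word q \<in> words"
    using Cons.prems(1) refl_words_words refl_word_words by auto
  have pq: "eqv n (refl_word p @ refl_word q) (refl_word q @ refl_word p)"
    using Cons.prems(2) by (simp add: commute_def)
  have IH: "eqv n (refl_word p @ refl_words ps) (refl_words ps @ refl_word p)"
    using Cons by simp
  have "eqv n (refl_word p @ refl_word q @ refl_words ps) (refl_word q @ refl_word p @ refl_words ps)"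
    by (rule eqv_subst[OF pq, of _ "[]" "refl_words ps"]) (use w in auto)
  also have "eqv n \<dots> (refl_word q @ refl_words ps @ refl_word p)"
    by (rule eqv_subst[OF IH, of _ "refl_word q" "[]"]) (use w in auto)
  finally show ?case by (simp add: refl_words_def)
qed

lemma refl_word_vector_word:
  assumes "p \<in> positions (n + 1)" "nat \<bar>p\<bar> \<in> set ks" "distinct ks" "set ks \<subseteq> {1..n + 1}"
  shows "eqv n (refl_word p @ vector_word v ks) (vector_word (flip p v) ks)"
  using assms(2-)
proof (induction ks)
  case (Cons k ks)
  let ?c = "refl_words (coord_refls k (v k))"
  have k: "1 \<le> k" "k \<le> n + 1" using Cons.prems by auto
  have w: "?c \<in> words" "vector_word v ks \<in> words"
    using refl_words_words[OF coord_refls_positions[OF k]] vector_word_words Cons.prems by auto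
  have vec: "vector_word v (k # ks) = refl_words (coord_refls k (v k)) @ vector_word v ks" for v
    by (simp add: vector_word_def)
  show ?case
  proof (cases "nat \<bar>p\<bar> = k")
    case True
    have "vector_word (flip p v) ks = vector_word v ks"
      using Cons.prems(2) True unfolding vector_word_def flip_def
      by (intro arg_cong[of _ _ concat] map_cong) auto
    moreover have "flip p v k = sgn p - v k" using True by (simp add: flip_def)
    moreover have "eqv n ((refl_word p @ ?c) @ vector_word v ks)
        (refl_words (coord_refls k (sgn p - v k)) @ vector_word v ks)"
      by (rule eqv_subst[OF refl_word_coord_refls[OF assms(1) True, of "v k"], of _ "[]" "vector_word v ks"])
        (use w in auto)
    ultimately show ?thesis by (simp add: vec)
  next
    case False
    have "eqv n (refl_word p @ ?c) (?c @ refl_word p)"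
    proof (rule refl_word_move[OF assms(1) coord_refls_positions[OF k]], rule ballI)
      fix q assume q: "q \<in> set (coord_refls k (v k))"
      then have "\<bar>q\<bar> = int k" using set_coord_refls[of k "v k"] by auto
      then show "commute p q"
        using False q coord_refls_positions[OF k] by (intro commute_positions assms(1)) auto
    qed
    then have "eqv n (refl_word p @ ?c @ vector_word v ks) (?c @ refl_word p @ vector_word v ks)"
      by (rule eqv_subst[of _ _ _ "[]" "vector_word v ks"]) (use w in auto)
    also have "eqv n \<dots> (?c @ vector_word (flip p v) ks)"
      by (rule eqv_subst[OF Cons.IH, of _ ?c "[]"]) (use Cons.prems False w in auto)
    finally show ?thesis using False by (simp add: vec flip_def fun_upd_def)
  qed
qed simp

text \<open>The product depends only on the image of the origin, as an identity in the presented
  group: each reflection moves through the other coordinates, with which it commutes, into the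
  dihedral word of its own.\<close>

lemma refl_words_vector_word:
  assumes "set ps \<subseteq> positions (n + 1)"
  shows "eqv n (refl_words ps) (vector_word (foldr flip ps (\<lambda>_. 0)) [1..<n + 2])"
  using assms
proof (induction ps)
  case Nil
  have "vector_word (\<lambda>_. 0) ks = []" for ks
    by (induction ks) (auto simp: vector_word_def refl_words_def coord_refls_def)
  then show ?case using eqv_refl[of "[]"] by (simp add: refl_words_def)
next
  case (Cons p ps)
  let ?v = "foldr flip ps (\<lambda>_. 0)"
  have p: "p \<in> positions (n + 1)" using Cons.prems by simp
  have "eqv n (refl_word p @ refl_words ps) (refl_word p @ vector_word ?v [1..<n + 2])"
    by (rule eqv_subst[OF Cons.IH, of _ "refl_word p" "[]"])
      (use Cons.prems refl_word_words[OF p] in auto)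
  also have "eqv n \<dots> (vector_word (flip p ?v) [1..<n + 2])"
    by (rule refl_word_vector_word[OF p]) (use p in \<open>auto simp: positions_def\<close>)
  finally show ?case by (simp add: refl_words_def)
qed

lemma flip_int:
  "k \<ge> 1 \<Longrightarrow> flip (int k) v = v(k := 1 - v k)"
  "k \<ge> 1 \<Longrightarrow> flip (- int k) v = v(k := - 1 - v k)"
  by (simp_all add: flip_def)

lemma act_pos_int:
  "s \<ge> 1 \<Longrightarrow> act_pos s (int s) = int (s + 1)"
  "s \<ge> 1 \<Longrightarrow> act_pos s (int (s + 1)) = int s"
  "s \<ge> 1 \<Longrightarrow> k \<noteq> s \<Longrightarrow> k \<noteq> s + 1 \<Longrightarrow> act_pos s (int k) = int k"
  "act_pos 0 (int 1) = - int 2"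
  "act_pos 0 (int 2) = - int 1"
  "k \<ge> 3 \<Longrightarrow> act_pos 0 (int k) = int k"
  by (simp_all add: act_pos_def)

text \<open>The counterpart of \<open>refl_word_conj\<close> for vectors; it keeps the image of the
  origin in step with the rewriting of words.\<close>

lemma flip_act_pos:
  assumes "p \<in> positions (n + 1)" "s \<le> n"
  shows "flip (act_pos s p) (gact n M s v) = gact n M s (flip p v)"
proof -
  obtain k where k: "1 \<le> k" "k \<le> n + 1" "p = int k \<or> p = - int k"
    by (rule positions_signed[OF assms(1)])
  show ?thesis
  proof (cases "s = 0")
    case True
    have g: "gact n M 0 v = v(1 := - v 2, 2 := - v 1)" for v by (simp add: gact_def)
    consider "k = 1" | "k = 2" | "k \<ge> 3" using k(1) by linarith
    then show ?thesis
    proof cases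
      case 1
      have "v(1 := - v 2, 2 := - v 1, 2 := c - (- v 1)) = (v(1 := - c - v 1))(1 := - v 2, 2 := - (- c - v 1))" for c
        by (simp add: fun_eq_iff)
      then show ?thesis using k(3) True 1 act_pos_minus[of 0 "int 1"] flip_int[of 1] flip_int[of 2]
        by (elim disjE) (simp_all only: act_pos_int g, simp_all add: fun_eq_iff)
    next
      case 2
      show ?thesis using k(3) True 2 act_pos_minus[of 0 "int 2"] flip_int[of 1] flip_int[of 2]
        by (elim disjE) (simp_all only: act_pos_int g, simp_all add: fun_eq_iff)
    next
      case 3
      then have "act_pos 0 p = p" using k(3) act_pos_minus[of 0 "int k"] act_pos_int(6)[of k] by auto
      then show ?thesis using k(1,3) True 3 flip_int[of k]
        by (elim disjE) (simp_all add: g fun_eq_iff)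
    qed
  next
    case False
    then have s1: "1 \<le> s" by simp
    have g: "gact n M s v = v(s := v (s + 1), s + 1 := v s)" for v
      using False assms(2) by (simp add: gact_def)
    consider "k = s" | "k = s + 1" | "k \<noteq> s" "k \<noteq> s + 1" by linarith
    then show ?thesis
    proof cases
      case 1
      then have "p = int s \<and> act_pos s p = int (s + 1) \<or> p = - int s \<and> act_pos s p = - int (s + 1)"
        using k(3) act_pos_int(1)[OF s1] act_pos_minus[of s "int s"] by metis
      then show ?thesis using flip_int[of s] flip_int[of "s + 1"] s1
        by (elim disjE conjE) (simp_all only: g, simp_all add: fun_eq_iff)
    next
      case 2
      then have "p = int (s + 1) \<and> act_pos s p = int s \<or> p = - int (s + 1) \<and> act_pos s p = - int s"
        using k(3) act_pos_int(2)[OF s1] act_pos_minus[of s "int (s + 1)"] by metis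
      then show ?thesis using flip_int[of s] flip_int[of "s + 1"] s1
        by (elim disjE conjE) (simp_all only: g, simp_all add: fun_eq_iff)
    next
      case 3
      then have "act_pos s p = p"
        using k(3) act_pos_int(3)[OF s1] act_pos_minus[of s "int k"] by metis
      then show ?thesis using flip_int[OF k(1)] k(3) 3
        by (elim disjE) (simp_all add: g fun_eq_iff)
    qed
  qed
qed

lemma refl_words_conj:
  assumes "set ps \<subseteq> positions (n + 1)" "s \<le> n"
  shows "eqv n (s # refl_words ps) (refl_words (map (act_pos s) ps) @ [s])"
  using assms(1)
proof (induction ps)
  case Nil
  then show ?case using assms(2) by (simp add: refl_words_def eqv_refl words_iff)
next
  case (Cons p ps)
  then have p: "p \<in> positions (n + 1)" "refl_words ps \<in> words"
    using refl_words_words by auto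
  have p': "refl_word (act_pos s p) \<in> words"
    by (intro refl_word_words act_pos_positions) (use p assms(2) n in auto)
  have IH: "eqv n (s # refl_words ps) (refl_words (map (act_pos s) ps) @ [s])"
    using Cons by simp
  have "eqv n (s # refl_word p @ refl_words ps) (refl_word (act_pos s p) @ [s] @ refl_words ps)"
    by (rule eqv_subst[OF refl_word_conj[OF p(1) assms(2)], of _ "[]" "refl_words ps"])
      (use p in auto)
  also have "eqv n \<dots> (refl_word (act_pos s p) @ refl_words (map (act_pos s) ps) @ [s])"
    by (rule eqv_subst[OF IH, of _ "refl_word (act_pos s p)" "[]"]) (use p' in auto)
  finally show ?case by (simp add: refl_words_def)
qed

lemma foldr_flip_act_pos:
  assumes "set ps \<subseteq> positions (n + 1)" "s \<le> n"
  shows "foldr flip (map (act_pos s) ps) (\<lambda>_. 0) = gact n 1 s (foldr flip ps (\<lambda>_. 0))"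
  using assms(1)
proof (induction ps)
  case Nil
  show ?case using assms(2) by (simp add: gact_def fun_eq_iff)
next
  case (Cons p ps)
  then show ?case using flip_act_pos[of p s 1] assms(2) by simp
qed

text \<open>The letter \<open>n + 1\<close> is itself the reflection at the top position. Any other
  letter is pushed to the right past the reflections, permuting their positions, and joins
  \<open>x\<close>.\<close>

lemma word_decomposition:
  assumes "u \<in> words"
  shows "\<exists>ps x. set ps \<subseteq> positions (n + 1) \<and> x \<in> lists {0..n} \<and> eqv n u (refl_words ps @ x) \<and>
    foldr (gact n 1) u (\<lambda>_. 0) = foldr flip ps (\<lambda>_. 0)"
  using assms
proof (induction u)
  case Nil
  have "eqv n [] (refl_words [] @ [])" using eqv_refl[of "[]"] by (simp add: refl_words_def)
  then show ?case by (intro exI[of _ "[]"]) simp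
next
  case (Cons s u)
  then have s: "s \<le> n + 1" "[s] \<in> words" "u \<in> words" by (auto simp: Btilde_gens_iff)
  obtain ps x where IH: "set ps \<subseteq> positions (n + 1)" "x \<in> lists {0..n}" "eqv n u (refl_words ps @ x)"
    "foldr (gact n 1) u (\<lambda>_. 0) = foldr flip ps (\<lambda>_. 0)" 
    using Cons.IH by blast
  have xw: "x \<in> words" using IH(2) by (auto simp: words_iff)
  have su: "eqv n (s # u) (s # refl_words ps @ x)"
    by (rule eqv_subst[OF IH(3), of _ "[s]" "[]"]) (use s in auto)
  show ?case
  proof (cases "s = n + 1")
    case True
    let ?p = "int n + 1"
    have p: "set (?p # ps) \<subseteq> positions (n + 1)" using IH(1) by (auto simp: positions_def)
    have "refl_word ?p = [s]" using True by (simp add: refl_word_def coset_word_top)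
    then have "eqv n (s # u) (refl_words (?p # ps) @ x)" using su by (simp add: refl_words_def)
    moreover have "gact n 1 s v = flip ?p v" for v
    proof -
      have "nat \<bar>?p\<bar> = n + 1" by simp
      then show ?thesis using True by (simp add: gact_def flip_def)
    qed
    then have "foldr (gact n 1) (s # u) (\<lambda>_. 0) = foldr flip (?p # ps) (\<lambda>_. 0)"
      using IH(4) by simp
    ultimately show ?thesis using p IH(2) by blast
  next
    case False
    then have s': "s \<le> n" using s by simp
    have "eqv n (s # refl_words ps @ x) (refl_words (map (act_pos s) ps) @ s # x)"
      by (rule eqv_subst[OF refl_words_conj[OF IH(1) s'], of _ "[]" x]) (use xw in auto)
    with su have "eqv n (s # u) (refl_words (map (act_pos s) ps) @ s # x)"
      by (rule eqv_trans)
    moreover have "set (map (act_pos s) ps) \<subseteq> positions (n + 1)"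
      using IH(1) act_pos_positions[of _ n s] s' n by auto
    moreover have "s # x \<in> lists {0..n}" using IH(2) s' by simp
    moreover have "foldr (gact n 1) (s # u) (\<lambda>_. 0) = foldr flip (map (act_pos s) ps) (\<lambda>_. 0)"
      using foldr_flip_act_pos[OF IH(1) s'] IH(4) by simp
    ultimately show ?thesis by blast
  qed
qed

text \<open>The stabilizer of the origin is generated by the letters \<open>0, \<dots>, n\<close>.\<close>

lemma same_coset:
  assumes "u \<in> words" "u' \<in> words"
    and "foldr (gact n 1) u (\<lambda>_. 0) = foldr (gact n 1) u' (\<lambda>_. 0)"
  shows "\<exists>x\<in>lists {0..n}. eqv n u (u' @ x)"
proof -
  obtain ps x where u: "set ps \<subseteq> positions (n + 1)" "x \<in> lists {0..n}" "eqv n u (refl_words ps @ x)"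
    "foldr (gact n 1) u (\<lambda>_. 0) = foldr flip ps (\<lambda>_. 0)"
    using word_decomposition[OF assms(1)] by blast
  obtain ps' x' where u': "set ps' \<subseteq> positions (n + 1)" "x' \<in> lists {0..n}"
    "eqv n u' (refl_words ps' @ x')" "foldr (gact n 1) u' (\<lambda>_. 0) = foldr flip ps' (\<lambda>_. 0)"
    using word_decomposition[OF assms(2)] by blast
  have "foldr flip ps (\<lambda>_. 0) = foldr flip ps' (\<lambda>_. 0)" using assms(3) u(4) u'(4) by simp
  then have eq: "eqv n (refl_words ps) (refl_words ps')"
    using refl_words_vector_word[OF u(1)] eqv_sym[OF refl_words_vector_word[OF u'(1)]]
    by (simp only:) (rule eqv_trans)
  have w: "x \<in> words" "x' \<in> words" "rev x' \<in> words" "refl_words ps' \<in> words"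
    using u(2) u'(2) refl_words_words[OF u'(1)] by (auto simp: words_iff)
  note u(3)
  also have "eqv n (refl_words ps @ x) (refl_words ps' @ x)"
    by (rule eqv_subst[OF eq, of _ "[]" x]) (use w in auto)
  also have "eqv n \<dots> (refl_words ps' @ x' @ rev x' @ x)"
    by (rule eqv_subst[OF eqv_sym[OF eqv_rev_right[OF w(2)]], of _ "refl_words ps'" x]) (use w in auto)
  also have "eqv n \<dots> (u' @ rev x' @ x)"
    by (rule eqv_subst[OF eqv_sym[OF u'(3)], of _ "[]" "rev x' @ x"]) (use w in auto)
  finally show ?thesis using u(2) u'(2) by (intro bexI[of _ "rev x' @ x"]) auto
qed

end

subsection \<open>The normal form\<close>

definition position :: "int \<Rightarrow> int" where
  "position j = (if j \<ge> 1 \<or> j = -1 then j else if j = 0 then -2 else j - 1)"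

lemma label_position: "label (position j) = j"
  by (simp add: label_def position_def)

lemma position_positions:
  "m \<ge> 1 \<Longrightarrow> - int m \<le> j \<Longrightarrow> j \<le> int m + 1 \<Longrightarrow> position j \<in> positions (m + 1)"
  by (auto simp: position_def positions_def)

lemma label_bounds:
  "m \<ge> 1 \<Longrightarrow> p \<in> positions (m + 1) \<Longrightarrow> - int m \<le> label p \<and> label p \<le> int m + 1"
  by (auto simp: label_def positions_def)

lemma block_word_label:
  assumes "set ps \<subseteq> positions (n + 1)"
  shows "block_word n (map label ps) = blocks n ps"
  using assms by (induction ps) (auto simp: block_word_def blocks_def bracket_label positions_def)

lemma length_coset_word:
  "p \<in> positions (m + 1) \<Longrightarrow> m \<ge> 1 \<Longrightarrow>
    int (length (coset_word p m)) = (if p > 0 then int m + 1 - p else int m - 1 - p)"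
  by (auto simp: coset_word_def positions_def)

context Btilde_rank begin

lemma length_bracket:
  assumes "p \<in> positions (n + 1)"
  shows "int (Btilde_length n (Btilde_elt n (bracket (label p) n))) =
    (if p > 0 then int n + 1 - p else int n - 1 - p)"
proof -
  have "p \<noteq> 0" using assms by (simp add: positions_def)
  have "lexmin_path n (period n) base_point (coset_word p n)"
    by (rule lexmin_path_coset_word[OF _ n assms]) (auto simp: dominant_def base_point_def)
  then have "Btilde_length n (Btilde_elt n (coset_word p n)) = length (coset_word p n)"
    by (rule lexmin_path_length[OF n coset_word_words[OF assms]])
  then show ?thesis
    using length_coset_word[OF assms] n bracket_label[OF \<open>p \<noteq> 0\<close>] by simp
qed

text \<open>The length strictly decreases in \<open>p\<close>, except that 1 and \<open>-1\<close>
  tie at \<open>n\<close>. Condition (c) lets this tie be crossed in either direction, and above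
  \<open>n\<close> equal lengths mean equal positions.\<close>

lemma follows_iff:
  assumes "p \<in> positions (n + 1)" "p' \<in> positions (n + 1)"
  defines "L \<equiv> \<lambda>p. Btilde_length n (Btilde_elt n (bracket (label p) n))"
  shows "follows p p' \<longleftrightarrow> label p' \<le> int n \<and> L p \<le> L p' \<and> (L p < n \<longrightarrow> L p < L p') \<and>
    (L p = n \<longrightarrow> L p < L p' \<or> label p' = - label p)"
proof -
  have L: "int (L p) = (if p > 0 then int n + 1 - p else int n - 1 - p)"
    "int (L p') = (if p' > 0 then int n + 1 - p' else int n - 1 - p')"
    using length_bracket assms(1,2) by (simp_all add: L_def)
  have cmp: "L p \<le> L p' \<longleftrightarrow> int (L p) \<le> int (L p')" "L p < L p' \<longleftrightarrow> int (L p) < int (L p')"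
    "L p < n \<longleftrightarrow> int (L p) < int n" "L p = n \<longleftrightarrow> int (L p) = int n" by simp_all
  have p: "p \<noteq> 0" "p \<le> int n + 1" "p' \<noteq> 0" "p' \<le> int n + 1" using assms by (auto simp: positions_def)
  consider "p \<ge> 2" | "p = 1" | "p = -1" | "p \<le> -2" using p(1) by linarith
  then show ?thesis
    unfolding cmp L using p n
    by cases (auto simp: follows_def label_def)
qed

lemma admissible_iff:
  "admissible n m js \<longleftrightarrow> (\<exists>ps. js = map label ps \<and> length ps = m \<and>
    set ps \<subseteq> positions (n + 1) \<and> successively follows ps)"
proof
  define L where "L p = Btilde_length n (Btilde_elt n (bracket (label p) n))" for p
  assume a: "admissible n m js"
  note a = a[unfolded admissible_def Let_def]
  let ?ps = "map position js"
  have len: "length js = m" using a by simp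
  have nth: "js ! i = label (?ps ! i)" if "i < m" for i
    using that len by (simp add: label_position)
  have range: "- int n \<le> js ! i \<and> js ! i \<le> int n + (if i = 0 then 1 else 0)" if i: "i < m" for i
  proof (cases "i = 0")
    case True
    then show ?thesis using a i by auto
  next
    case False
    then have "Suc i \<in> {2..m}" using i by auto
    then show ?thesis using a False by (metis diff_Suc_1 add.right_neutral)
  qed
  have pos: "?ps ! i \<in> positions (n + 1)" if "i < m" for i
  proof -
    have "position (js ! i) \<in> positions (n + 1)"
      by (rule position_positions) (use range[OF that] n in \<open>auto split: if_splits\<close>)
    then show ?thesis using that len by simp
  qed
  have "follows (?ps ! i) (?ps ! Suc i)" if i: "Suc i < m" for i
  proof -
    have "i < m" using i by simp
    have "1 \<le> Suc i \<and> Suc i + 1 \<le> m" using i by simp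
    then have "L (?ps ! i) \<le> L (?ps ! Suc i) \<and>
      (L (?ps ! i) < n \<longrightarrow> L (?ps ! i) < L (?ps ! Suc i)) \<and>
      (L (?ps ! i) = n \<longrightarrow> L (?ps ! i) < L (?ps ! Suc i) \<or> js ! Suc i = - (js ! i))"
      using a unfolding L_def nth[OF i, symmetric] nth[OF \<open>i < m\<close>, symmetric]
      by (metis Suc_eq_plus1 diff_Suc_1)
    then show ?thesis
      using follows_iff[OF pos[OF \<open>i < m\<close>] pos[OF i]] range[OF i]
      unfolding L_def nth[OF i] nth[OF \<open>i < m\<close>] by simp
  qed
  then have "successively follows ?ps"
    using len by (simp add: successively_conv_nth)
  moreover have "set ?ps \<subseteq> positions (n + 1)"
    using pos len by (auto simp: in_set_conv_nth)
  moreover have "js = map label ?ps" by (simp add: o_def label_position)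
  ultimately show "\<exists>ps. js = map label ps \<and> length ps = m \<and>
      set ps \<subseteq> positions (n + 1) \<and> successively follows ps"
    using len by (intro exI[of _ ?ps]) simp
next
  assume "\<exists>ps. js = map label ps \<and> length ps = m \<and> set ps \<subseteq> positions (n + 1) \<and> successively follows ps"
  then obtain ps where ps: "js = map label ps" "length ps = m" "set ps \<subseteq> positions (n + 1)"
    "successively follows ps" by blast
  have pos: "ps ! i \<in> positions (n + 1)" if "i < m" for i using that ps by auto
  have follows: "follows (ps ! i) (ps ! Suc i)" if "Suc i < m" for i
    using ps that by (simp add: successively_conv_nth)
  have nth: "js ! i = label (ps ! i)" if "i < m" for i using ps that by simp
  show "admissible n m js"
    unfolding admissible_def Let_def
  proof (intro conjI allI impI ballI)
    show "length js = m" using ps by simp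
  next
    assume "1 \<le> m"
    then show "- int n \<le> js ! (1 - 1)" "js ! (1 - 1) \<le> int n + 1"
      using label_bounds[of n "ps ! 0"] pos[of 0] nth[of 0] n by simp_all
  next
    fix s assume "s \<in> {2..m}"
    then obtain i where i: "s - 1 = Suc i" "Suc i < m" by (intro that[of "s - 2"]) auto
    show "- int n \<le> js ! (s - 1)"
      using label_bounds[OF _ pos[OF i(2)]] nth[OF i(2)] i n by simp
    show "js ! (s - 1) \<le> int n"
      using follows_iff[OF pos pos, of i "Suc i"] follows[OF i(2)] i nth[OF i(2)] by simp
  next
    fix s assume s: "1 \<le> s \<and> s + 1 \<le> m"
    then obtain i where i: "s = Suc i" "Suc i < m" by (cases s) auto
    then have "i < m" by simp
    have e: "js ! (s - 1) = label (ps ! i)" "js ! (s + 1 - 1) = label (ps ! Suc i)"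
      using i nth[OF \<open>i < m\<close>] nth[OF i(2)] by simp_all
    note f = follows[OF i(2), unfolded follows_iff[OF pos[OF \<open>i < m\<close>] pos[OF i(2)]]]
    show "Btilde_length n (Btilde_elt n (bracket (js ! (s - 1)) n))
        \<le> Btilde_length n (Btilde_elt n (bracket (js ! (s + 1 - 1)) n))"
      unfolding e using f by blast
    show "Btilde_length n (Btilde_elt n (bracket (js ! (s - 1)) n))
        < Btilde_length n (Btilde_elt n (bracket (js ! (s + 1 - 1)) n))"
      if "Btilde_length n (Btilde_elt n (bracket (js ! (s - 1)) n)) < n"
      using f that unfolding e by blast
    show "Btilde_length n (Btilde_elt n (bracket (js ! (s - 1)) n))
        < Btilde_length n (Btilde_elt n (bracket (js ! (s + 1 - 1)) n)) \<or>
        js ! (s + 1 - 1) = - js ! (s - 1)"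
      if "Btilde_length n (Btilde_elt n (bracket (js ! (s - 1)) n)) = n"
      using f that unfolding e by blast
  qed
qed

section \<open>Existence and uniqueness of the decomposition\<close>

lemma blocks_words: "set ps \<subseteq> positions (n + 1) \<Longrightarrow> blocks n ps \<in> words"
  using coset_word_words last_word by (induction ps) (auto simp: blocks_def)

lemma count_blocks:
  assumes "set ps \<subseteq> positions (n + 1)"
  shows "count_list (blocks n ps) (n + 1) = length ps"
  using assms
proof (induction ps)
  case (Cons p ps)
  then have "set (coset_word p n) \<subseteq> {0..n}" using n by (intro coset_word_letters) auto
  then have "n + 1 \<notin> set (coset_word p n)" by auto
  then have "count_list (coset_word p n) (n + 1) = 0" by (simp only: count_list_0_iff) simp
  then show ?case using Cons by (simp add: blocks_def)
qed (simp add: blocks_def)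

lemma W_D_eq: "W_D n = Btilde_elt n ` lists {0..n}"
proof -
  interpret W: group "W_Btilde n" by (rule group_W_Btilde)
  have sub: "lists {0..n} \<subseteq> words" by (auto simp: Btilde_gens_iff)
  have carrier: "carrier (W_Btilde n) = Btilde_elt n ` words" by (simp add: coxeter_group_def)
  have unit: "\<one>\<^bsub>W_Btilde n\<^esub> = Btilde_elt n []" by (simp add: coxeter_group_def)
  have mult: "Btilde_elt n u \<otimes>\<^bsub>W_Btilde n\<^esub> Btilde_elt n v = Btilde_elt n (u @ v)"
    if "u \<in> lists {0..n}" "v \<in> lists {0..n}" for u v
    using that sub by (intro coxeter_group_mult) auto
  have invol: "inv\<^bsub>W_Btilde n\<^esub> (Btilde_elt n [s]) = Btilde_elt n [s]" if "s \<le> n" for s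
  proof (rule W.inv_equality)
    have s: "[s] \<in> lists {0..n}" using that by simp
    have "[s] \<in> words" using s sub by blast
    then show "Btilde_elt n [s] \<in> carrier (W_Btilde n)" "Btilde_elt n [s] \<in> carrier (W_Btilde n)"
      unfolding carrier by (rule imageI)+
    have "[s, s] \<in> words" using that by (auto simp: Btilde_gens_iff)
    then show "Btilde_elt n [s] \<otimes>\<^bsub>W_Btilde n\<^esub> Btilde_elt n [s] = \<one>\<^bsub>W_Btilde n\<^esub>"
      unfolding mult[OF s s] unit using eqv_square[of s] that by (simp add: cox_elt_eq_iff)
  qed
  show ?thesis
  proof (intro equalityI subsetI)
    fix x assume "x \<in> W_D n"
    then show "x \<in> Btilde_elt n ` lists {0..n}"
      unfolding W_D_def
    proof (induction x rule: generate.induct)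
      case one
      show ?case unfolding unit by (intro imageI) simp
    next
      case (incl h)
      then obtain s where "h = Btilde_elt n [s]" "s \<le> n" by auto
      then show ?case by (intro image_eqI[of _ _ "[s]"]) auto
    next
      case (inv h)
      then obtain s where "h = Btilde_elt n [s]" "s \<le> n" by auto
      then show ?case using invol by (intro image_eqI[of _ _ "[s]"]) auto
    next
      case (eng h1 h2)
      then obtain u v where "h1 = Btilde_elt n u" "u \<in> lists {0..n}" "h2 = Btilde_elt n v" "v \<in> lists {0..n}"
        by auto
      then show ?case using mult[of u v] by (intro image_eqI[of _ _ "u @ v"]) auto
    qed
  next
    fix x assume "x \<in> Btilde_elt n ` lists {0..n}"
    then obtain u where "u \<in> lists {0..n}" "x = Btilde_elt n u" by auto
    then show "x \<in> W_D n"
    proof (induction u arbitrary: x)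
      case Nil
      then show ?case unfolding W_D_def using unit generate.one by metis
    next
      case (Cons s u)
      have su: "[s] \<in> lists {0..n}" "u \<in> lists {0..n}" using Cons by auto
      have "Btilde_elt n [s] \<in> W_D n"
        unfolding W_D_def by (rule generate.incl) (use su in auto)
      moreover have "Btilde_elt n u \<in> W_D n" using Cons su by blast
      ultimately have "Btilde_elt n [s] \<otimes>\<^bsub>W_Btilde n\<^esub> Btilde_elt n u \<in> W_D n"
        unfolding W_D_def by (rule generate.eng)
      then show ?case using mult[OF su] Cons(4) by simp
    qed
  qed
qed

lemma foldr_gact_eqv:
  assumes "eqv n u v"
  shows "foldr (gact n 1) u q = foldr (gact n 1) v q"
  using fold_gact_eqv[OF eqv_rev[OF assms] n] by (simp add: foldr_conv_fold)

lemma foldr_gact_stabilizer: "x \<in> lists {0..n} \<Longrightarrow> foldr (gact n 1) x (\<lambda>_. 0) = (\<lambda>_. 0)"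
  by (induction x) (auto simp: gact_def fun_eq_iff)

lemma foldr_fold_gact: "foldr (gact n 1) u (fold (gact n 1) u v) = v"
  by (induction u arbitrary: v) (auto simp: gact_invol)

lemma fold_foldr_gact: "fold (gact n 1) u (foldr (gact n 1) u v) = v"
  by (induction u arbitrary: v) (auto simp: gact_invol)

lemma gact_outside: "i \<notin> {1..n + 1} \<Longrightarrow> s \<le> n + 1 \<Longrightarrow> gact n M s v i = v i"
  using n by (auto simp: gact_def)

text \<open>The factor \<open>x\<close> fixes the origin, so the image of the origin under
  \<open>u\<close> comes from the blocks alone, and \<open>fold\<close> undoes it.\<close>

lemma vanishes_blocks:
  assumes "set ps \<subseteq> positions (n + 1)" "x \<in> lists {0..n}" "eqv n u (blocks n ps @ x)"
  shows "vanishes n (fold (gact n 1) (blocks n ps) (foldr (gact n 1) u (\<lambda>_. 0)))"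
proof -
  have "foldr (gact n 1) u (\<lambda>_. 0) = foldr (gact n 1) (blocks n ps) (\<lambda>_. 0)"
    using foldr_gact_eqv[OF assms(3)] foldr_gact_stabilizer[OF assms(2)] by simp
  then show ?thesis by (simp add: fold_foldr_gact vanishes_def)
qed

lemma decomposition_exists:
  assumes "u \<in> words"
  shows "\<exists>ps x. set ps \<subseteq> positions (n + 1) \<and> successively follows ps \<and> x \<in> lists {0..n} \<and>
    eqv n u (blocks n ps @ x)"
proof -
  define v where "v = foldr (gact n 1) u (\<lambda>_. 0)"
  obtain ps where ps: "set ps \<subseteq> positions (n + 1)" "successively follows ps"
    "vanishes n (fold (gact n 1) (blocks n ps) v)" using blocks_exist[OF n] by blast
  have bw: "blocks n ps \<in> words" by (rule blocks_words[OF ps(1)])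
  have "fold (gact n 1) (blocks n ps) v = (\<lambda>_. 0)"
  proof
    fix i
    show "fold (gact n 1) (blocks n ps) v i = 0"
    proof (cases "i \<in> {1..n + 1}")
      case True
      then show ?thesis using ps(3) by (simp add: vanishes_def)
    next
      \<comment> \<open>\<open>vanishes\<close> concerns the indices 1 to \<open>n + 1\<close> only,
        but comparing cosets needs equality of functions; no letter touches the other
        indices.\<close>
      case False
      have "fold (gact n 1) w v i = v i" if "w \<in> words" for w
        using that gact_outside[OF False] by (induction w arbitrary: v) (auto simp: Btilde_gens_iff)
      moreover have "foldr (gact n 1) w (\<lambda>_. 0) i = 0" if "w \<in> words" for w
        using that gact_outside[OF False] by (induction w) (auto simp: Btilde_gens_iff)
      ultimately show ?thesis using bw assms by (simp add: v_def)
    qed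
  qed
  then have "foldr (gact n 1) (blocks n ps) (\<lambda>_. 0) = v" by (metis foldr_fold_gact)
  then obtain x where "x \<in> lists {0..n}" "eqv n u (blocks n ps @ x)"
    using same_coset[OF assms bw] by (auto simp: v_def)
  then show ?thesis using ps by blast
qed

lemma decomposition_unique:
  assumes "set ps \<subseteq> positions (n + 1)" "successively follows ps" "x \<in> lists {0..n}"
    and "eqv n u (blocks n ps @ x)"
    and "set ps' \<subseteq> positions (n + 1)" "successively follows ps'" "x' \<in> lists {0..n}"
    and "eqv n u (blocks n ps' @ x')"
  shows "ps = ps' \<and> eqv n x x'"
proof -
  have ps: "ps = ps'"
    by (rule blocks_unique[OF n assms(1,2) vanishes_blocks[OF assms(1,3,4)] assms(5,6)
          vanishes_blocks[OF assms(5,7,8)]])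
  let ?b = "blocks n ps"
  have b: "?b \<in> words" "rev ?b \<in> words" and x: "x \<in> words" "x' \<in> words"
    using blocks_words[OF assms(1)] assms(3,7) by (auto simp: words_iff)
  have "eqv n x (rev ?b @ ?b @ x)"
    by (rule eqv_subst[OF eqv_sym[OF eqv_rev_left[OF b(1)]], of _ "[]" x]) (use x in auto)
  also have "eqv n \<dots> (rev ?b @ u)"
    by (rule eqv_subst[OF eqv_sym[OF assms(4)], of _ "rev ?b" "[]"]) (use b in auto)
  also have "eqv n \<dots> (rev ?b @ ?b @ x')"
    by (rule eqv_subst[OF assms(8), of _ "rev ?b" "[]"]) (use b ps in auto)
  also have "eqv n \<dots> x'"
    by (rule eqv_subst[OF eqv_rev_left[OF b(1)], of _ "[]" x']) (use x in auto)
  finally show ?thesis using ps by blast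
qed

lemma decomposition:
  assumes "w \<in> carrier (W_Btilde n)"
  shows "\<exists>!(m, js, x). admissible n m js \<and> x \<in> W_D n \<and>
    w = Btilde_elt n (block_word n js) \<otimes>\<^bsub>W_Btilde n\<^esub> x"
proof -
  obtain u where u: "u \<in> words" "w = Btilde_elt n u"
    using assms by (auto simp: coxeter_group_def)
  have prod: "w = Btilde_elt n (blocks n ps) \<otimes>\<^bsub>W_Btilde n\<^esub> Btilde_elt n x \<longleftrightarrow> eqv n u (blocks n ps @ x)"
    if "set ps \<subseteq> positions (n + 1)" "x \<in> lists {0..n}" for ps x
  proof -
    have "x \<in> words" using that(2) by (auto simp: words_iff)
    then show ?thesis
      using coxeter_group_mult[OF blocks_words[OF that(1)]] u by (simp add: cox_elt_eq_iff)
  qed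
  obtain ps x where px: "set ps \<subseteq> positions (n + 1)" "successively follows ps" "x \<in> lists {0..n}"
    "eqv n u (blocks n ps @ x)" using decomposition_exists[OF u(1)] by blast
  show ?thesis
  proof (rule ex1I[of _ "(length ps, map label ps, Btilde_elt n x)"], goal_cases)
    case 1
    have "admissible n (length ps) (map label ps)" unfolding admissible_iff using px by blast
    moreover have "Btilde_elt n x \<in> W_D n" using px(3) by (simp add: W_D_eq)
    ultimately show ?case using prod[OF px(1,3)] px(4) block_word_label[OF px(1)] by simp
  next
    case (2 z)
    obtain m js y where z: "z = (m, js, y)" by (cases z) auto
    then have y: "admissible n m js" "y \<in> W_D n"
      "w = Btilde_elt n (block_word n js) \<otimes>\<^bsub>W_Btilde n\<^esub> y" using 2 by simp_all
    obtain ps' where ps': "js = map label ps'" "length ps' = m" "set ps' \<subseteq> positions (n + 1)"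
      "successively follows ps'" using y(1) unfolding admissible_iff by blast
    obtain x' where x': "x' \<in> lists {0..n}" "y = Btilde_elt n x'"
      using y(2) by (auto simp: W_D_eq)
    have "eqv n u (blocks n ps' @ x')"
      using y(3) prod[OF ps'(3) x'(1)] block_word_label[OF ps'(3)] ps'(1) x'(2) by simp
    then have eq: "ps = ps'" "eqv n x x'"
      using decomposition_unique[OF px ps'(3,4) x'(1)] by blast+
    have "x \<in> words" using px(3) by (auto simp: words_iff)
    then have "Btilde_elt n x = Btilde_elt n x'" using eq(2) by (simp add: cox_elt_eq_iff)
    then show ?case using z ps'(1,2) x'(2) eq(1) by simp
  qed
qed

end

theorem theorem6p7:
  fixes n :: nat
  assumes "n \<ge> 3"
  shows "(\<forall>w\<in>carrier (W_Btilde n).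
            \<exists>!(m, js, x). admissible n m js \<and> x \<in> W_D n \<and>
              w = Btilde_elt n (block_word n js) \<otimes>\<^bsub>W_Btilde n\<^esub> x) \<and>
         (\<forall>m js. admissible n m js \<longrightarrow>
            reduced (Btilde_gens n) (Btilde_matrix n) (block_word n js) \<and>
            right_lex_min (Btilde_gens n) (Btilde_matrix n) (block_word n js) \<and>
            affine_length n (Btilde_elt n (block_word n js)) = m)"
proof -
  interpret Btilde_rank n by unfold_locales (rule assms)
  show ?thesis
  proof (intro conjI ballI allI impI)
    fix w assume "w \<in> carrier (W_Btilde n)"
    then show "\<exists>!(m, js, x). admissible n m js \<and> x \<in> W_D n \<and>
        w = Btilde_elt n (block_word n js) \<otimes>\<^bsub>W_Btilde n\<^esub> x" by (rule decomposition)
  next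
    fix m js assume "admissible n m js"
    then obtain ps where ps: "js = map label ps" "length ps = m" "set ps \<subseteq> positions (n + 1)"
      "successively follows ps" unfolding admissible_iff by blast
    then have b: "block_word n js = blocks n ps" by (simp add: block_word_label)
    note lexmin = lexmin_path_right_lex_min[OF assms blocks_words[OF ps(3)]
        lexmin_path_blocks_base[OF assms ps(3,4)]]
    show "reduced (Btilde_gens n) (Btilde_matrix n) (block_word n js)"
      "right_lex_min (Btilde_gens n) (Btilde_matrix n) (block_word n js)"
      "affine_length n (Btilde_elt n (block_word n js)) = m"
      using lexmin count_blocks[OF ps(3)] ps(2) unfolding b by simp_all
  qed
qed

end
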